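(* Let $\Omega=(0,1)^d$, let $k\in\mathbb{N}$, let $\sigma\in W^{k,1}_{\mathrm{loc}}(\mathbb{R})$ be an activation function and let $\varphi$ be a norm function for $\sigma$. For $m\in\{0,\dots,k\}$ define $\varphi_m(x):=\varphi(x)/(1+\mathrm{ReLU}(x))^m$, where $\mathrm{ReLU}(x)=\max(0,x)$. Assume that there is a constant $C>0$ with $$|\partial_x^m\sigma(x)|\le C\,\varphi_m(|x|),\qquad 0\le m\le k,$$ and that $\varphi_k$ is non-decreasing and positive. Then for every $f\in B_\sigma^\varphi(\Omega)$ of the form $f(x)=\int_{\mathbb{R}^{d+1}}\sigma(w\cdot x+b)\,\mathrm{d}\rho(w,b)$ with $\rho\in\mathcal{M}^\varphi(\mathbb{R}^{d+1})$, and every multi-index $\alpha$ with $|\alpha|\le k$, the weak derivative of $f$ is $$\partial_x^\alpha f(x)=\int_{\mathbb{R}^{d+1}}w^\alpha\,(\partial_x^{|\alpha|}\sigma)(w\cdot x+b)\,\mathrm{d}\rho(w,b).$$ Moreover, $B_\sigma^\varphi(\Omega)\hookrightarrow W^{k,\infty}(\Omega)$ continuously; i.e. there is a constant $C'>0$ with $\|f\|_{W^{k,\infty}(\Omega)}\le C'\|f\|_{B_\sigma^\varphi(\Omega)}$ for all $f\in B_\sigma^\varphi(\Omega)$.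
   Context: An activation function is a Borel-measurable map $\sigma:\mathbb{R}\to\mathbb{C}$. A function $\varphi:[0,\infty)\to(0,\infty)$ is a norm function for $\sigma$ if $\varphi$ is (positive and) non-decreasing and there is a constant $C>0$ with $|\sigma(x)|\le C\varphi(|x|)$ for all $x\in\mathbb{R}$. Let $\mathcal{M}(\mathbb{R}^{d+1};\mathbb{C})$ be the space of finite complex Radon measures on $\mathbb{R}^{d+1}$, with points written $(w,b)$, $w\in\mathbb{R}^d$, $b\in\mathbb{R}$, and let $|\rho|$ denote total variation. Put $\mathcal{M}^\varphi(\mathbb{R}^{d+1})=\{\rho\in\mathcal{M}(\mathbb{R}^{d+1};\mathbb{C}):\int\varphi(\|w\|_1+|b|)\,\mathrm{d}|\rho|<\infty\}$. The generalized Barron space $B_\sigma^\varphi(\Omega)$ is the set of measurable $f:\Omega\to\mathbb{C}$ (identified when equal almost everywhere) for which there is $\rho\in\mathcal{M}^\varphi(\mathbb{R}^{d+1})$ with $f(x)=\int_{\mathbb{R}^{d+1}}\sigma(w\cdot x+b)\,\mathrm{d}\rho(w,b)$ for a.e. $x\in\Omega$ (a representing measure of $f$), and $\|f\|_{B_\sigma^\varphi(\Omega)}=\inf_\rho\int_{\mathbb{R}^{d+1}}\varphi(\|w\|_1+|b|)\,\mathrm{d}|\rho|$, the infimum being over all representing measures $\rho\in\mathcal{M}^\varphi(\mathbb{R}^{d+1})$ of $f$. *)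

theory Defs
  imports "HOL-Analysis.Analysis" "HOL-Probability.Essential_Supremum"
begin

section \<open>Complex measures\<close>

text \<open>A complex measure is a countably additive set function on the Borel sets; its values
  on other sets are irrelevant. The limit is finite by the type, and \<open>\<rho> {} = 0\<close> follows by
  taking every set empty. On a Euclidean space such a measure is automatically finite and Radon.\<close>

definition complex_measure :: "('b::topological_space set \<Rightarrow> complex) \<Rightarrow> bool" where
  "complex_measure \<rho> \<longleftrightarrow>
    (\<forall>A :: nat \<Rightarrow> 'b set. range A \<subseteq> sets borel \<longrightarrow> disjoint_family A \<longrightarrow>
      (\<lambda>i. \<rho> (A i)) sums \<rho> (\<Union>i. A i))"

definition total_variation :: "('b::topological_space set \<Rightarrow> complex) \<Rightarrow> 'b measure" where
  "total_variation \<rho> = measure_of UNIV (sets borel)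
    (\<lambda>A. SUP E \<in> {E :: nat \<Rightarrow> 'b set. range E \<subseteq> sets borel \<and> disjoint_family E \<and> (\<Union>i. E i) = A}.
       (\<Sum>i. ennreal (cmod (\<rho> (E i)))))"

text \<open>The positive part of the Jordan decomposition of a real measure \<open>\<nu>\<close>; the negative part
  is the positive part of \<open>- \<nu>\<close>. The coercion \<open>ennreal\<close> sends negative numbers to \<open>0\<close>,
  which is harmless since the empty set is among the competitors.\<close>

definition positive_variation :: "('b::topological_space set \<Rightarrow> real) \<Rightarrow> 'b measure" where
  "positive_variation \<nu> = measure_of UNIV (sets borel)
    (\<lambda>A. SUP B \<in> {B. B \<in> sets borel \<and> B \<subseteq> A}. ennreal (\<nu> B))"

definition signed_integral :: "('b::topological_space set \<Rightarrow> real) \<Rightarrow> ('b \<Rightarrow> complex) \<Rightarrow> complex" where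
  "signed_integral \<nu> g =
     integral\<^sup>L (positive_variation \<nu>) g - integral\<^sup>L (positive_variation (\<lambda>A. - \<nu> A)) g"

definition complex_integral :: "('b::topological_space set \<Rightarrow> complex) \<Rightarrow> ('b \<Rightarrow> complex) \<Rightarrow> complex" where
  "complex_integral \<rho> g =
     signed_integral (\<lambda>A. Re (\<rho> A)) g + \<i> * signed_integral (\<lambda>A. Im (\<rho> A)) g"


section \<open>Weak derivatives and Sobolev spaces\<close>

text \<open>Multi-indices are functions \<open>\<alpha>\<close> on the standard basis; their values elsewhere are never
  used. On the real line, whose basis is \<open>{1}\<close>, the multi-index of order \<open>m\<close> is \<open>\<lambda>_. m\<close>.\<close>

definition mi_order :: "('a::euclidean_space \<Rightarrow> nat) \<Rightarrow> nat" where
  "mi_order \<alpha> = (\<Sum>b\<in>Basis. \<alpha> b)"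

definition mi_power :: "'a::euclidean_space \<Rightarrow> ('a \<Rightarrow> nat) \<Rightarrow> real" where
  "mi_power w \<alpha> = (\<Prod>b\<in>Basis. (w \<bullet> b) ^ \<alpha> b)"

primrec iter_partial :: "'a::euclidean_space list \<Rightarrow> ('a \<Rightarrow> real) \<Rightarrow> 'a \<Rightarrow> real" where
  "iter_partial [] \<psi> = \<psi>"
| "iter_partial (b # bs) \<psi> = (\<lambda>x. deriv (\<lambda>t. iter_partial bs \<psi> (x + t *\<^sub>R b)) 0)"

text \<open>The classical derivative \<open>\<partial>\<^sup>\<alpha>\<close>, which is applied to smooth functions only; the order
  in which the partial derivatives are taken is then immaterial.\<close>

definition mi_partial :: "('a::euclidean_space \<Rightarrow> nat) \<Rightarrow> ('a \<Rightarrow> real) \<Rightarrow> 'a \<Rightarrow> real" where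
  "mi_partial \<alpha> = iter_partial (SOME bs. set bs \<subseteq> Basis \<and> (\<forall>b\<in>Basis. count_list bs b = \<alpha> b))"

definition smooth_function :: "('a::euclidean_space \<Rightarrow> real) \<Rightarrow> bool" where
  "smooth_function \<psi> \<longleftrightarrow> (\<forall>bs. set bs \<subseteq> Basis \<longrightarrow> iter_partial bs \<psi> differentiable_on UNIV)"

definition test_function :: "'a::euclidean_space set \<Rightarrow> ('a \<Rightarrow> real) \<Rightarrow> bool" where
  "test_function \<Omega> \<psi> \<longleftrightarrow> smooth_function \<psi> \<and>
     compact (closure {x. \<psi> x \<noteq> 0}) \<and> closure {x. \<psi> x \<noteq> 0} \<subseteq> \<Omega>"

definition locally_integrable :: "'a::euclidean_space set \<Rightarrow> ('a \<Rightarrow> complex) \<Rightarrow> bool" where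
  "locally_integrable \<Omega> f \<longleftrightarrow> (\<forall>K. compact K \<and> K \<subseteq> \<Omega> \<longrightarrow> set_integrable lebesgue K f)"

text \<open>\<open>g\<close> is (a representative of) the weak derivative \<open>\<partial>\<^sup>\<alpha> f\<close> on the open set \<open>\<Omega>\<close>.\<close>

definition has_weak_deriv ::
    "'a::euclidean_space set \<Rightarrow> ('a \<Rightarrow> nat) \<Rightarrow> ('a \<Rightarrow> complex) \<Rightarrow> ('a \<Rightarrow> complex) \<Rightarrow> bool" where
  "has_weak_deriv \<Omega> \<alpha> f g \<longleftrightarrow> locally_integrable \<Omega> f \<and> locally_integrable \<Omega> g \<and>
     (\<forall>\<psi>. test_function \<Omega> \<psi> \<longrightarrow>
        (LINT x:\<Omega>|lebesgue. mi_partial \<alpha> \<psi> x *\<^sub>R f x) =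
        (- 1) ^ mi_order \<alpha> * (LINT x:\<Omega>|lebesgue. \<psi> x *\<^sub>R g x))"

definition sobolev_loc_1 :: "nat \<Rightarrow> 'a::euclidean_space set \<Rightarrow> ('a \<Rightarrow> complex) set" where
  "sobolev_loc_1 k \<Omega> = {f. \<forall>\<alpha>. mi_order \<alpha> \<le> k \<longrightarrow> (\<exists>g. has_weak_deriv \<Omega> \<alpha> f g)}"

definition Linf_norm :: "'a::euclidean_space set \<Rightarrow> ('a \<Rightarrow> complex) \<Rightarrow> ennreal" where
  "Linf_norm \<Omega> f = esssup (lebesgue_on \<Omega>) (\<lambda>x. ennreal (cmod (f x)))"

definition sobolev_inf :: "nat \<Rightarrow> 'a::euclidean_space set \<Rightarrow> ('a \<Rightarrow> complex) set" where
  "sobolev_inf k \<Omega> =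
     {f. \<forall>\<alpha>. mi_order \<alpha> \<le> k \<longrightarrow> (\<exists>g. has_weak_deriv \<Omega> \<alpha> f g \<and> Linf_norm \<Omega> g < \<infinity>)}"

text \<open>The norm of \<open>W\<^sup>k\<^sup>,\<^sup>\<infinity>\<close>: the maximum of the \<open>L\<^sup>\<infinity>\<close> norms of the weak derivatives of order
  at most \<open>k\<close>. The infimum only ranges over the representatives of \<open>\<partial>\<^sup>\<alpha> f\<close>, which agree almost
  everywhere and so have the same norm; if \<open>\<partial>\<^sup>\<alpha> f\<close> does not exist, it is \<open>\<infinity>\<close>. The supremum
  has only finitely many distinct terms.\<close>

definition sobolev_inf_norm :: "nat \<Rightarrow> 'a::euclidean_space set \<Rightarrow> ('a \<Rightarrow> complex) \<Rightarrow> ennreal" where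
  "sobolev_inf_norm k \<Omega> f =
     (SUP \<alpha> \<in> {\<alpha>. mi_order \<alpha> \<le> k}. INF g \<in> {g. has_weak_deriv \<Omega> \<alpha> f g}. Linf_norm \<Omega> g)"


section \<open>Generalized Barron spaces\<close>

definition activation_function :: "(real \<Rightarrow> complex) \<Rightarrow> bool" where
  "activation_function \<sigma> \<longleftrightarrow> \<sigma> \<in> borel_measurable borel"

definition norm_function :: "(real \<Rightarrow> complex) \<Rightarrow> (real \<Rightarrow> real) \<Rightarrow> bool" where
  "norm_function \<sigma> \<phi> \<longleftrightarrow> (\<forall>x\<ge>0. 0 < \<phi> x) \<and> mono_on {0..} \<phi> \<and>
     (\<exists>C>0. \<forall>x. cmod (\<sigma> x) \<le> C * \<phi> \<bar>x\<bar>)"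

definition norm1 :: "'a::euclidean_space \<Rightarrow> real" where
  "norm1 w = (\<Sum>b\<in>Basis. \<bar>w \<bullet> b\<bar>)"

definition weighted_mass :: "(real \<Rightarrow> real) \<Rightarrow> (('a::euclidean_space \<times> real) set \<Rightarrow> complex) \<Rightarrow> ennreal" where
  "weighted_mass \<phi> \<rho> = (\<integral>\<^sup>+ (w, b). ennreal (\<phi> (norm1 w + \<bar>b\<bar>)) \<partial>total_variation \<rho>)"

definition weighted_measures :: "(real \<Rightarrow> real) \<Rightarrow> (('a::euclidean_space \<times> real) set \<Rightarrow> complex) set" where
  "weighted_measures \<phi> = {\<rho>. complex_measure \<rho> \<and> weighted_mass \<phi> \<rho> < \<infinity>}"

text \<open>If \<open>\<phi>\<close> is a norm function for \<open>\<sigma>\<close> and \<open>\<rho>\<close> is in \<open>weighted_measures \<phi>\<close>, then the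
  integrand below is integrable for every \<open>x\<close>.\<close>

definition represents ::
    "(real \<Rightarrow> complex) \<Rightarrow> 'a::euclidean_space set \<Rightarrow>
      (('a \<times> real) set \<Rightarrow> complex) \<Rightarrow> ('a \<Rightarrow> complex) \<Rightarrow> bool" where
  "represents \<sigma> \<Omega> \<rho> f \<longleftrightarrow>
     (AE x in lebesgue_on \<Omega>. f x = complex_integral \<rho> (\<lambda>(w, b). \<sigma> (w \<bullet> x + b)))"

text \<open>Functions are not quotiented by equality almost everywhere; membership and norm are
  invariant under it and only depend on the values on \<open>\<Omega>\<close>.\<close>

definition barron_space ::
    "(real \<Rightarrow> complex) \<Rightarrow> (real \<Rightarrow> real) \<Rightarrow> 'a::euclidean_space set \<Rightarrow> ('a \<Rightarrow> complex) set" where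
  "barron_space \<sigma> \<phi> \<Omega> = {f. f \<in> borel_measurable (lebesgue_on \<Omega>) \<and>
     (\<exists>\<rho> \<in> weighted_measures \<phi>. represents \<sigma> \<Omega> \<rho> f)}"

definition barron_norm ::
    "(real \<Rightarrow> complex) \<Rightarrow> (real \<Rightarrow> real) \<Rightarrow> 'a::euclidean_space set \<Rightarrow> ('a \<Rightarrow> complex) \<Rightarrow> ennreal" where
  "barron_norm \<sigma> \<phi> \<Omega> f =
     (INF \<rho> \<in> {\<rho> \<in> weighted_measures \<phi>. represents \<sigma> \<Omega> \<rho> f}. weighted_mass \<phi> \<rho>)"

definition reduced_norm_function :: "(real \<Rightarrow> real) \<Rightarrow> nat \<Rightarrow> real \<Rightarrow> real" where
  "reduced_norm_function \<phi> m x = \<phi> x / (1 + max 0 x) ^ m"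

end

theory Submission
  imports Defs
begin

text \<open>The weak derivative of \<open>f\<close> is obtained by differentiating under the integral over the parameters
  \<open>(w, b)\<close>. This rests on two facts about the ridge functions \<open>x \<mapsto> \<sigma> (w \<bullet> x + b)\<close>.

  The first is a bound. On the unit cube, \<open>\<bar>w \<bullet> x + b\<bar> \<le> \<parallel>w\<parallel>\<^sub>1 + \<bar>b\<bar>\<close>, and all reduced norm functions up
  to order \<open>k\<close> are non-decreasing; so the derivative of order \<open>m\<close> is at most \<open>C \<phi>(r) / (1 + r)\<^sup>m\<close> with
  \<open>r = \<parallel>w\<parallel>\<^sub>1 + \<bar>b\<bar>\<close>, and the denominator absorbs the factor \<open>w\<^sup>\<alpha>\<close> that the chain rule produces. Hence
  \<open>w\<^sup>\<alpha> \<sigma>\<^sup>(\<^sup>m\<^sup>)(w \<bullet> x + b)\<close> is dominated by \<open>C \<phi>(r)\<close> (\<open>ridge_cutoff_bound\<close>), whose integral is finite. This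
  justifies Fubini's theorem (\<open>complex_integral_Fubini\<close>) and bounds the supremum of every derivative by
  a multiple of the weighted mass of \<open>\<rho>\<close>, which is the continuity of the embedding.

  The second is the chain rule (\<open>ridge_partial\<close>, \<open>ridge_iter_partial\<close>). To integrate
  \<open>\<partial>\<^sub>e\<psi>(x) h(w \<bullet> x + b)\<close> by parts, one integrates first along the lines in the direction \<open>e\<close>. If
  \<open>w \<bullet> e \<noteq> 0\<close>, the ridge function is an affine reparametrization of \<open>h\<close> on such a line, and \<open>\<psi>\<close> is a
  test function of one variable, so the assertion is the definition of the weak derivative of \<open>h\<close>. If
  \<open>w \<bullet> e = 0\<close>, the ridge function is constant on the line, and both sides vanish.

  The bounds hold outside a null set of the real line only. For \<open>w \<noteq> 0\<close> its preimage under
  \<open>x \<mapsto> w \<bullet> x + b\<close> is again a null set (\<open>AE_ridge\<close>); for \<open>w = 0\<close> the factor \<open>w\<^sup>\<alpha>\<close> vanishes if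
  \<open>\<alpha> \<noteq> 0\<close>, and for \<open>\<alpha> = 0\<close> the bound on \<open>\<sigma>\<close> holds everywhere.

  The complex measure enters through its total variation, which has to be recognized as a measure
  (\<open>emeasure_total_variation\<close>), and through the four positive measures in the definition of the
  complex integral, which the total variation dominates (\<open>jordan_parts_le\<close>).\<close>

section \<open>Total variation\<close>

lemma complex_measure_empty:
  assumes "complex_measure \<rho>"
  shows "\<rho> {} = 0"
proof -
  have "(\<lambda>i::nat. \<rho> {}) sums \<rho> (\<Union>i::nat. {})"
    using assms unfolding complex_measure_def by (auto simp: disjoint_family_on_def)
  then have "(\<lambda>i::nat. \<rho> {}) \<longlonglongrightarrow> 0"
    by (intro summable_LIMSEQ_zero sums_summable)
  then show ?thesis by (simp add: LIMSEQ_const_iff)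
qed

definition countable_partitions :: "'b::topological_space set \<Rightarrow> (nat \<Rightarrow> 'b set) set" where
  "countable_partitions A =
    {E. range E \<subseteq> sets borel \<and> disjoint_family E \<and> (\<Union>i. E i) = A}"

definition variation :: "('b::topological_space set \<Rightarrow> complex) \<Rightarrow> 'b set \<Rightarrow> ennreal" where
  "variation \<rho> A = (SUP E \<in> countable_partitions A. \<Sum>i. ennreal (cmod (\<rho> (E i))))"

lemma total_variation_altdef:
  "total_variation \<rho> = measure_of UNIV (sets borel) (variation \<rho>)"
  unfolding total_variation_def variation_def countable_partitions_def ..

lemma partition_concat:
  assumes A: "disjoint_family A" and E: "\<And>n. E n \<in> countable_partitions (A n)"
  shows "(\<lambda>i. E (fst (prod_decode i)) (snd (prod_decode i))) \<in> countable_partitions (\<Union>n. A n)"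
proof -
  let ?G = "\<lambda>i. E (fst (prod_decode i)) (snd (prod_decode i))"
  have sub: "E m n \<subseteq> A m" for m n using E[of m] unfolding countable_partitions_def by auto
  have "?G i \<inter> ?G j = {}" if "i \<noteq> j" for i j
  proof (cases "fst (prod_decode i) = fst (prod_decode j)")
    case True
    then have "snd (prod_decode i) \<noteq> snd (prod_decode j)"
      using that by (metis prod.expand prod_decode_inverse)
    then show ?thesis
      using E[of "fst (prod_decode i)"] True
      unfolding countable_partitions_def disjoint_family_on_def by auto
  next
    case False
    then have "A (fst (prod_decode i)) \<inter> A (fst (prod_decode j)) = {}"
      using A unfolding disjoint_family_on_def by auto
    then show ?thesis using sub by blast
  qed
  moreover have "(\<Union>i. ?G i) = (\<Union>n. A n)"
  proof
    show "(\<Union>i. ?G i) \<subseteq> (\<Union>n. A n)" using sub by blast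
    show "(\<Union>n. A n) \<subseteq> (\<Union>i. ?G i)"
    proof
      fix x assume "x \<in> (\<Union>n. A n)"
      then obtain n where "x \<in> A n" by auto
      then obtain m where "x \<in> E n m" using E[of n] unfolding countable_partitions_def by auto
      then have "x \<in> ?G (prod_encode (n, m))" by simp
      then show "x \<in> (\<Union>i. ?G i)" by blast
    qed
  qed
  moreover have "range ?G \<subseteq> sets borel"
    using E unfolding countable_partitions_def by blast
  ultimately show ?thesis
    unfolding countable_partitions_def disjoint_family_on_def by blast
qed

lemma partition_trivial:
  assumes "A \<in> sets borel"
  shows "(\<lambda>i::nat. if i = 0 then A else {}) \<in> countable_partitions A"
proof -
  have "(\<Union>i::nat. if i = 0 then A else {}) = A" by (auto split: if_splits)
  moreover have "range (\<lambda>i::nat. if i = 0 then A else {}) \<subseteq> sets borel" using assms by auto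
  moreover have "disjoint_family (\<lambda>i::nat. if i = 0 then A else {})"
    by (simp add: disjoint_family_on_def)
  ultimately show ?thesis unfolding countable_partitions_def by simp
qed

text \<open>Partitions of \<open>A\<close> and \<open>B\<close> merge into a partition of \<open>A \<union> B\<close>.\<close>

lemma variation_superadditive:
  fixes A B :: "'b::topological_space set"
  assumes \<rho>: "complex_measure \<rho>" and disj: "A \<inter> B = {}"
    and meas: "A \<in> sets borel" "B \<in> sets borel"
  shows "variation \<rho> A + variation \<rho> B \<le> variation \<rho> (A \<union> B)"
proof -
  let ?v = "\<lambda>E. \<Sum>i. ennreal (cmod (\<rho> (E i)))"
  have ne: "countable_partitions C \<noteq> {}" if "C \<in> sets borel" for C :: "'b set"
  proof -
    have "(\<lambda>i::nat. if i = 0 then C else {}) \<in> countable_partitions C"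
      using that partition_trivial by blast
    then show ?thesis by auto
  qed
  have key: "?v E + ?v F \<le> variation \<rho> (A \<union> B)"
    if E: "E \<in> countable_partitions A" and F: "F \<in> countable_partitions B" for E F
  proof -
    \<comment> \<open>The two partitions are the first two rows of a double sequence whose other rows are empty.\<close>
    define D where "D n = (if n = 0 then A else if n = Suc 0 then B else {})" for n :: nat
    define H where "H n = (if n = 0 then E else if n = Suc 0 then F else (\<lambda>_. {}))" for n :: nat
    have dis: "disjoint_family D" using disj by (auto simp: disjoint_family_on_def D_def)
    have H: "H n \<in> countable_partitions (D n)" for n
      using E F by (simp add: H_def D_def) (simp add: countable_partitions_def disjoint_family_on_def)
    have D: "(\<Union>n. D n) = A \<union> B"
      by (auto simp: D_def split: if_splits)
    have mem:
      "(\<lambda>i. H (fst (prod_decode i)) (snd (prod_decode i))) \<in> countable_partitions (A \<union> B)"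
      using partition_concat[OF dis H] unfolding D .
    have "(\<Sum>i. ennreal (cmod (\<rho> (H (fst (prod_decode i)) (snd (prod_decode i)))))) = (\<Sum>n. ?v (H n))"
      by (rule suminf_ennreal_2dimen[where f = "\<lambda>p. ennreal (cmod (\<rho> (H (fst p) (snd p))))"])
         (simp only: fst_conv snd_conv)
    also have "\<dots> = (\<Sum>n\<in>{0, Suc 0}. ?v (H n))"
      by (rule suminf_finite) (auto simp: H_def complex_measure_empty[OF \<rho>])
    also have "\<dots> = ?v (H 0) + ?v (H (Suc 0))"
      by (subst sum.insert) auto
    also have "\<dots> = ?v E + ?v F"
      unfolding H_def by simp
    finally show ?thesis
      unfolding variation_def by (intro SUP_upper2[OF mem]) simp
  qed
  have "variation \<rho> A + variation \<rho> B
      = (SUP E\<in>countable_partitions A. SUP F\<in>countable_partitions B. ?v E + ?v F)"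
    unfolding variation_def
    by (subst ennreal_SUP_add_left[symmetric], rule ne[OF meas(1)])
       (simp add: ennreal_SUP_add_right[OF ne[OF meas(2)]])
  also have "\<dots> \<le> variation \<rho> (A \<union> B)"
    by (intro SUP_least key)
  finally show ?thesis .
qed

text \<open>Cutting a partition of the union along the sets \<open>A n\<close> can only increase its sum, by the
  triangle inequality.\<close>

lemma variation_countably_subadditive:
  fixes A :: "nat \<Rightarrow> 'b::topological_space set"
  assumes \<rho>: "complex_measure \<rho>" and A: "disjoint_family A" and meas: "range A \<subseteq> sets borel"
  shows "variation \<rho> (\<Union>n. A n) \<le> (\<Sum>n. variation \<rho> (A n))"
  unfolding variation_def[of \<rho> "\<Union>n. A n"]
proof (rule SUP_least)
  fix E assume "E \<in> countable_partitions (\<Union>n. A n)"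
  then have E: "range E \<subseteq> sets borel" "disjoint_family E" "(\<Union>i. E i) = (\<Union>n. A n)"
    by (auto simp: countable_partitions_def)
  have split: "ennreal (cmod (\<rho> (E i))) \<le> (\<Sum>n. ennreal (cmod (\<rho> (E i \<inter> A n))))" for i
  proof (cases "(\<Sum>n. ennreal (cmod (\<rho> (E i \<inter> A n)))) = top")
    case False
    have "(\<lambda>n. \<rho> (E i \<inter> A n)) sums \<rho> (\<Union>n. E i \<inter> A n)"
    proof -
      have "range (\<lambda>n. E i \<inter> A n) \<subseteq> sets borel" using E(1) meas by auto
      moreover have "disjoint_family (\<lambda>n. E i \<inter> A n)"
        using A by (auto simp: disjoint_family_on_def)
      ultimately show ?thesis using \<rho> unfolding complex_measure_def by blast
    qed
    moreover have "(\<Union>n. E i \<inter> A n) = E i" using E(3) by auto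
    ultimately have s: "(\<lambda>n. \<rho> (E i \<inter> A n)) sums \<rho> (E i)" by simp
    have sm: "summable (\<lambda>n. cmod (\<rho> (E i \<inter> A n)))"
      using False by (intro summable_suminf_not_top) auto
    have "cmod (\<rho> (E i)) \<le> (\<Sum>n. cmod (\<rho> (E i \<inter> A n)))"
      using summable_norm[OF sm] sums_unique[OF s] by simp
    then show ?thesis
      using sm by (subst suminf_ennreal2) (auto intro: ennreal_leI)
  qed simp
  have "(\<Sum>i. ennreal (cmod (\<rho> (E i)))) \<le> (\<Sum>i. \<Sum>n. ennreal (cmod (\<rho> (E i \<inter> A n))))"
    by (intro suminf_le split) auto
  also have "\<dots> = (\<Sum>n. \<Sum>i. ennreal (cmod (\<rho> (E i \<inter> A n))))"
    using nn_integral_suminf[of "\<lambda>n i. ennreal (cmod (\<rho> (E i \<inter> A n)))" "count_space UNIV"]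
    by (simp only: nn_integral_count_space_nat measurable_count_space_eq1 UNIV_I space_borel
        Pi_UNIV simp_thms)
  also have "\<dots> \<le> (\<Sum>n. variation \<rho> (A n))"
  proof (intro suminf_le)
    fix n
    have "(\<lambda>i. E i \<inter> A n) \<in> countable_partitions (A n)"
      using E meas by (auto simp: countable_partitions_def disjoint_family_on_def)
    then show "(\<Sum>i. ennreal (cmod (\<rho> (E i \<inter> A n)))) \<le> variation \<rho> (A n)"
      unfolding variation_def by (rule SUP_upper)
  qed auto
  finally show "(\<Sum>i. ennreal (cmod (\<rho> (E i)))) \<le> (\<Sum>n. variation \<rho> (A n))" .
qed

lemma variation_empty:
  assumes "complex_measure \<rho>"
  shows "variation \<rho> {} = 0"
  using complex_measure_empty[OF assms]
  unfolding variation_def countable_partitions_def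
  by (intro antisym SUP_least) simp_all

lemma sets_total_variation [simp, measurable_cong]: "sets (total_variation \<rho>) = sets borel"
  unfolding total_variation_def by (rule sets.sets_measure_of_eq[of borel, unfolded space_borel])

lemma space_total_variation [simp]: "space (total_variation \<rho>) = UNIV"
  unfolding total_variation_def by (simp add: space_measure_of_conv)

text \<open>This is what gives the weighted mass its content: \<open>measure_of\<close> turns a set function that is not
  countably additive into the zero measure. Superadditivity for two sets gives it for finite unions
  by induction, and with monotonicity for countable ones.\<close>

lemma emeasure_total_variation:
  assumes \<rho>: "complex_measure \<rho>" and A: "A \<in> sets borel"
  shows "emeasure (total_variation \<rho>) A = variation \<rho> A"
proof (rule emeasure_measure_of[OF total_variation_altdef])
  show "positive (sets (total_variation \<rho>)) (variation \<rho>)"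
    by (simp add: positive_def variation_empty[OF \<rho>])
  show "countably_additive (sets (total_variation \<rho>)) (variation \<rho>)"
    unfolding countably_additive_def
  proof (intro allI impI)
    fix B :: "nat \<Rightarrow> 'a set"
    assume "range B \<subseteq> sets (total_variation \<rho>)" and B: "disjoint_family B"
    then have meas: "range B \<subseteq> sets borel" by simp
    have fin: "(\<Sum>n<N. variation \<rho> (B n)) \<le> variation \<rho> (\<Union>n<N. B n)" for N
    proof (induction N)
      case (Suc N)
      have "B n \<inter> B N = {}" if "n < N" for n
        using B that unfolding disjoint_family_on_def by auto
      then have "(\<Union>n<N. B n) \<inter> B N = {}" by blast
      then have "variation \<rho> (\<Union>n<N. B n) + variation \<rho> (B N) \<le> variation \<rho> ((\<Union>n<N. B n) \<union> B N)"
        using meas by (intro variation_superadditive[OF \<rho>]) auto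
      moreover have "(\<Union>n<N. B n) \<union> B N = (\<Union>n<Suc N. B n)" by (auto simp: less_Suc_eq)
      ultimately show ?case
        using Suc order_trans[OF add_right_mono[OF Suc, of "variation \<rho> (B N)"]] by simp
    qed simp
    have mono: "variation \<rho> (\<Union>n<N. B n) \<le> variation \<rho> (\<Union>n. B n)" for N
    proof -
      have *: "(\<Union>n. B n) = (\<Union>n<N. B n) \<union> ((\<Union>n. B n) - (\<Union>n<N. B n))" by auto
      have "variation \<rho> (\<Union>n<N. B n) + variation \<rho> ((\<Union>n. B n) - (\<Union>n<N. B n)) \<le> variation \<rho> (\<Union>n. B n)"
        using meas by (subst *, intro variation_superadditive[OF \<rho>]) auto
      then show ?thesis
        using order_trans[OF add_left_mono[OF zero_le], of "variation \<rho> (\<Union>n<N. B n)"] by simp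
    qed
    have "(\<Sum>n. variation \<rho> (B n)) \<le> variation \<rho> (\<Union>n. B n)"
      by (rule suminf_le_const) (auto intro: order_trans[OF fin mono])
    then show "(\<Sum>n. variation \<rho> (B n)) = variation \<rho> (\<Union>n. B n)"
      using variation_countably_subadditive[OF \<rho> B meas] by (rule antisym)
  qed
qed (use A in auto)

lemma cmod_le_total_variation:
  assumes \<rho>: "complex_measure \<rho>" and A: "A \<in> sets borel"
  shows "ennreal (cmod (\<rho> A)) \<le> emeasure (total_variation \<rho>) A"
proof -
  let ?E = "\<lambda>i::nat. if i = 0 then A else {}"
  have mem: "?E \<in> countable_partitions A"
    using A by (rule partition_trivial)
  have "(\<Sum>i. ennreal (cmod (\<rho> (?E i)))) = (\<Sum>i\<in>{0}. ennreal (cmod (\<rho> (?E i))))"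
    by (rule suminf_finite) (auto simp: complex_measure_empty[OF \<rho>])
  then show ?thesis
    unfolding emeasure_total_variation[OF assms] variation_def
    by (intro SUP_upper2[OF mem]) simp
qed

lemma sets_positive_variation [simp, measurable_cong]: "sets (positive_variation \<nu>) = sets borel"
  unfolding positive_variation_def by (rule sets.sets_measure_of_eq[of borel, unfolded space_borel])

lemma space_positive_variation [simp]: "space (positive_variation \<nu>) = UNIV"
  unfolding positive_variation_def by (simp add: space_measure_of_conv)

text \<open>A measure built by \<open>measure_of\<close> from a set function either has its values or is zero; in both
  cases the positive variation of \<open>A\<close> is at most the supremum of \<open>\<nu> B\<close> over the subsets of \<open>A\<close>.\<close>

lemma positive_variation_le_total_variation:
  assumes \<rho>: "complex_measure \<rho>" and \<nu>: "\<And>B. B \<in> sets borel \<Longrightarrow> \<bar>\<nu> B\<bar> \<le> cmod (\<rho> B)"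
  shows "positive_variation \<nu> \<le> total_variation \<rho>"
proof -
  have "emeasure (positive_variation \<nu>) A \<le> emeasure (total_variation \<rho>) A"
    if A: "A \<in> sets borel" for A
  proof -
    have "emeasure (positive_variation \<nu>) A \<le> (SUP B\<in>{B. B \<in> sets borel \<and> B \<subseteq> A}. ennreal (\<nu> B))"
      unfolding positive_variation_def emeasure_measure_of_conv by simp
    also have "\<dots> \<le> emeasure (total_variation \<rho>) A"
    proof (rule SUP_least)
      fix B assume B: "B \<in> {B. B \<in> sets borel \<and> B \<subseteq> A}"
      have "ennreal (\<nu> B) \<le> ennreal (cmod (\<rho> B))" using \<nu>[of B] B by (intro ennreal_leI) auto
      also have "\<dots> \<le> emeasure (total_variation \<rho>) B" using B by (intro cmod_le_total_variation[OF \<rho>]) auto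
      also have "\<dots> \<le> emeasure (total_variation \<rho>) A" using A B by (intro emeasure_mono) auto
      finally show "ennreal (\<nu> B) \<le> emeasure (total_variation \<rho>) A" .
    qed
    finally show ?thesis .
  qed
  then show ?thesis by (subst le_measure) auto
qed

text \<open>The positive measures whose integrals make up the complex integral, collected in a set so that
  a claim about all four of them can be proved at once.\<close>

definition jordan_parts :: "('b::topological_space set \<Rightarrow> complex) \<Rightarrow> 'b measure set" where
  "jordan_parts \<rho> = {positive_variation (\<lambda>A. Re (\<rho> A)), positive_variation (\<lambda>A. - Re (\<rho> A)),
     positive_variation (\<lambda>A. Im (\<rho> A)), positive_variation (\<lambda>A. - Im (\<rho> A))}"

lemma jordan_parts_le:
  assumes "complex_measure \<rho>" "P \<in> jordan_parts \<rho>"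
  shows "P \<le> total_variation \<rho>"
  using assms(2) unfolding jordan_parts_def
  by (auto intro!: positive_variation_le_total_variation[OF assms(1)] abs_Re_le_cmod abs_Im_le_cmod)

lemma sets_jordan_parts: "P \<in> jordan_parts \<rho> \<Longrightarrow> sets P = sets borel"
  by (auto simp: jordan_parts_def)

lemma space_jordan_parts: "P \<in> jordan_parts \<rho> \<Longrightarrow> space P = UNIV"
  by (auto simp: jordan_parts_def)

lemma AE_jordan_parts:
  assumes "complex_measure \<rho>" "P \<in> jordan_parts \<rho>" "AE p in total_variation \<rho>. Q p"
  shows "AE p in P. Q p"
proof -
  obtain N where N: "{p \<in> space (total_variation \<rho>). \<not> Q p} \<subseteq> N" "N \<in> sets (total_variation \<rho>)"
      "emeasure (total_variation \<rho>) N = 0"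
    using assms(3) by (auto elim: AE_E)
  have "emeasure P N \<le> emeasure (total_variation \<rho>) N"
    using jordan_parts_le[OF assms(1,2)] N(2) sets_jordan_parts[OF assms(2)] by (subst (asm) le_measure) auto
  then have "emeasure P N = 0" using N(3) by simp
  then show ?thesis
    using N(1,2) sets_jordan_parts[OF assms(2)] space_jordan_parts[OF assms(2)]
    by (intro AE_I[of _ _ N]) auto
qed

lemma nn_integral_jordan_parts_le:
  assumes "complex_measure \<rho>" "P \<in> jordan_parts \<rho>"
  shows "integral\<^sup>N P f \<le> integral\<^sup>N (total_variation \<rho>) f"
  using assms by (intro nn_integral_mono_measure jordan_parts_le) (auto simp: sets_jordan_parts)

lemma complex_integral_jordan_parts:
  "complex_integral \<rho> g = integral\<^sup>L (positive_variation (\<lambda>A. Re (\<rho> A))) g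
     - integral\<^sup>L (positive_variation (\<lambda>A. - Re (\<rho> A))) g
     + \<i> * (integral\<^sup>L (positive_variation (\<lambda>A. Im (\<rho> A))) g
     - integral\<^sup>L (positive_variation (\<lambda>A. - Im (\<rho> A))) g)"
  unfolding complex_integral_def signed_integral_def ..

lemma jordan_parts_mem:
  "positive_variation (\<lambda>A. Re (\<rho> A)) \<in> jordan_parts \<rho>"
  "positive_variation (\<lambda>A. - Re (\<rho> A)) \<in> jordan_parts \<rho>"
  "positive_variation (\<lambda>A. Im (\<rho> A)) \<in> jordan_parts \<rho>"
  "positive_variation (\<lambda>A. - Im (\<rho> A)) \<in> jordan_parts \<rho>"
  by (auto simp: jordan_parts_def)

text \<open>The factor \<open>4\<close> counts the parts, each of which is at most the total variation. A part for which
  \<open>g\<close> is not integrable contributes the default value \<open>0\<close> of the Bochner integral.\<close>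

lemma complex_integral_bound:
  assumes \<rho>: "complex_measure \<rho>"
    and bound: "\<And>p. ennreal (cmod (g p)) \<le> B p"
  shows "ennreal (cmod (complex_integral \<rho> g)) \<le> 4 * integral\<^sup>N (total_variation \<rho>) B"
proof -
  let ?I = "integral\<^sup>N (total_variation \<rho>) B"
  have b: "ennreal (cmod (integral\<^sup>L P g)) \<le> ?I" if P: "P \<in> jordan_parts \<rho>" for P
  proof -
    have "ennreal (cmod (integral\<^sup>L P g)) \<le> (\<integral>\<^sup>+p. ennreal (cmod (g p)) \<partial>P)"
      by (cases "integrable P g") (auto simp: integral_norm_bound_ennreal not_integrable_integral_eq)
    also have "\<dots> \<le> integral\<^sup>N P B" by (intro nn_integral_mono bound)
    also have "\<dots> \<le> ?I" by (rule nn_integral_jordan_parts_le[OF \<rho> P])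
    finally show ?thesis .
  qed
  let ?c = "\<lambda>\<nu>. cmod (integral\<^sup>L (positive_variation \<nu>) g)"
  have "cmod (complex_integral \<rho> g) \<le> (?c (\<lambda>A. Re (\<rho> A)) + ?c (\<lambda>A. - Re (\<rho> A)))
      + (?c (\<lambda>A. Im (\<rho> A)) + ?c (\<lambda>A. - Im (\<rho> A)))"
    unfolding complex_integral_jordan_parts
    by (rule norm_triangle_mono[OF norm_triangle_ineq4]) (simp add: norm_mult norm_triangle_ineq4)
  then have "ennreal (cmod (complex_integral \<rho> g)) \<le> ennreal ((?c (\<lambda>A. Re (\<rho> A)) + ?c (\<lambda>A. - Re (\<rho> A)))
      + (?c (\<lambda>A. Im (\<rho> A)) + ?c (\<lambda>A. - Im (\<rho> A))))"
    by (rule ennreal_leI)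
  also have "\<dots> \<le> (?I + ?I) + (?I + ?I)"
    by (simp only: ennreal_plus norm_ge_zero add_nonneg_nonneg)
       (intro add_mono b jordan_parts_mem)
  also have "\<dots> = 4 * ?I"
    by (simp flip: mult_2 mult.assoc)
  finally show ?thesis .
qed

lemma complex_integral_cong_AE:
  assumes \<rho>: "complex_measure \<rho>" and "g \<in> borel_measurable borel" "h \<in> borel_measurable borel"
    and "AE p in total_variation \<rho>. g p = h p"
  shows "complex_integral \<rho> g = complex_integral \<rho> h"
proof -
  have "integral\<^sup>L P g = integral\<^sup>L P h" if P: "P \<in> jordan_parts \<rho>" for P
    using assms(2,3) AE_jordan_parts[OF \<rho> P assms(4)] sets_jordan_parts[OF P]
    by (intro integral_cong_AE) (simp_all cong: measurable_cong_sets)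
  then show ?thesis by (simp add: complex_integral_jordan_parts jordan_parts_mem)
qed

section \<open>Test functions and their restrictions to lines\<close>

lemma iter_partial_append: "iter_partial (as @ bs) \<psi> = iter_partial as (iter_partial bs \<psi>)"
  by (induction as) auto

lemma smooth_function_iter_partial:
  assumes "smooth_function \<psi>" "set bs \<subseteq> Basis"
  shows "smooth_function (iter_partial bs \<psi>)"
  using assms unfolding smooth_function_def by (auto simp flip: iter_partial_append)

lemma smooth_function_differentiable:
  assumes "smooth_function \<psi>"
  shows "\<psi> differentiable (at x)"
proof -
  have "iter_partial [] \<psi> differentiable_on UNIV"
    using assms unfolding smooth_function_def by (metis empty_set empty_subsetI)
  then show ?thesis by (simp add: differentiable_on_def)
qed

lemma smooth_function_continuous: "smooth_function \<psi> \<Longrightarrow> continuous_on UNIV \<psi>"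
  by (meson continuous_at_imp_continuous_on differentiable_imp_continuous_within
      smooth_function_differentiable)

lemma smooth_function_borel: "smooth_function \<psi> \<Longrightarrow> \<psi> \<in> borel_measurable borel"
  by (intro borel_measurable_continuous_onI smooth_function_continuous)

lemma smooth_function_line_derivative:
  fixes \<psi> :: "'a::euclidean_space \<Rightarrow> real"
  assumes "smooth_function \<psi>"
  shows "((\<lambda>t. \<psi> (x + t *\<^sub>R e)) has_real_derivative iter_partial [e] \<psi> (x + t *\<^sub>R e)) (at t)"
proof -
  have "(\<lambda>u. \<psi> (x + t *\<^sub>R e + u *\<^sub>R e)) differentiable (at 0)"
    by (rule differentiable_compose[of \<psi>])
       (auto intro!: smooth_function_differentiable[OF assms] derivative_intros)
  then obtain D where D: "((\<lambda>u. \<psi> (x + t *\<^sub>R e + u *\<^sub>R e)) has_real_derivative D) (at 0)"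
    using real_differentiable_def by blast
  then have "D = iter_partial [e] \<psi> (x + t *\<^sub>R e)"
    by (simp add: DERIV_imp_deriv)
  moreover have "((\<lambda>u. \<psi> (x + (u + t) *\<^sub>R e)) has_real_derivative D) (at 0)"
    using D by (simp add: algebra_simps)
  ultimately show ?thesis
    using DERIV_shift[of "\<lambda>t. \<psi> (x + t *\<^sub>R e)" D 0 t] by simp
qed

lemma iter_partial_line:
  fixes G :: "'a::euclidean_space \<Rightarrow> real"
  assumes "smooth_function G" "e \<in> Basis"
  shows "iter_partial (replicate n (1::real)) (\<lambda>s. G (x + (a * s) *\<^sub>R e))
    = (\<lambda>s. a ^ n * iter_partial (replicate n e) G (x + (a * s) *\<^sub>R e))"
proof (induction n)
  case (Suc n)
  let ?K = "iter_partial (replicate n e) G"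
  have K: "smooth_function ?K"
    using assms by (intro smooth_function_iter_partial) auto
  have D: "((\<lambda>t. a ^ n * ?K (x + (a * (s + t * 1)) *\<^sub>R e)) has_real_derivative
      a ^ n * (iter_partial [e] ?K (x + (a * (s + 0 * 1)) *\<^sub>R e) * a)) (at 0)" for s :: real
    by (intro DERIV_cmult DERIV_chain2[OF smooth_function_line_derivative[OF K]])
       (auto intro!: derivative_eq_intros)
  show ?case
    using DERIV_imp_deriv[OF D] by (simp add: Suc.IH fun_eq_iff)
qed simp

lemma list_over_Basis_real: "set bs \<subseteq> (Basis :: real set) \<Longrightarrow> bs = replicate (length bs) 1"
  by (induction bs) auto

lemma smooth_function_line:
  fixes G :: "'a::euclidean_space \<Rightarrow> real"
  assumes G: "smooth_function G" and e: "e \<in> Basis"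
  shows "smooth_function (\<lambda>s::real. G (x + (a * s) *\<^sub>R e))"
  unfolding smooth_function_def
proof (intro allI impI)
  fix bs :: "real list" assume "set bs \<subseteq> Basis"
  then obtain n where bs: "bs = replicate n 1" using list_over_Basis_real by blast
  let ?K = "iter_partial (replicate n e) G"
  have K: "smooth_function ?K"
    using assms by (intro smooth_function_iter_partial) auto
  have "((\<lambda>s. a ^ n * ?K (x + (a * s) *\<^sub>R e)) has_real_derivative
      a ^ n * (iter_partial [e] ?K (x + (a * s) *\<^sub>R e) * a)) (at s)" for s :: real
    by (intro DERIV_cmult DERIV_chain2[OF smooth_function_line_derivative[OF K]])
       (auto intro!: derivative_eq_intros)
  then have "(\<lambda>s::real. a ^ n * ?K (x + (a * s) *\<^sub>R e)) differentiable (at s)" for s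
    using real_differentiable_def by blast
  then show "iter_partial bs (\<lambda>s. G (x + (a * s) *\<^sub>R e)) differentiable_on UNIV"
    unfolding bs iter_partial_line[OF assms]
    by (simp add: differentiable_on_def)
qed

lemma test_function_iter_partial:
  assumes "test_function \<Omega> \<psi>" "set bs \<subseteq> Basis"
  shows "test_function \<Omega> (iter_partial bs \<psi>)"
proof -
  have "{x. iter_partial bs \<psi> x \<noteq> 0} \<subseteq> closure {x. \<psi> x \<noteq> 0}"
  proof (induction bs)
    case Nil
    then show ?case using closure_subset[of "{x. \<psi> x \<noteq> 0}"] by simp
  next
    case (Cons e bs)
    let ?S = "closure {x. \<psi> x \<noteq> 0}"
    have "iter_partial (e # bs) \<psi> x = 0" if x: "x \<notin> ?S" for x
    proof -
      have "((\<lambda>t::real. x + t *\<^sub>R e) \<longlongrightarrow> x + 0 *\<^sub>R e) (nhds 0)"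
        by (intro tendsto_intros filterlim_ident)
      then have "eventually (\<lambda>t. x + t *\<^sub>R e \<in> - ?S) (nhds (0::real))"
        using x by (intro topological_tendstoD[of _ _ _ "- ?S"]) auto
      then have "eventually (\<lambda>t. iter_partial bs \<psi> (x + t *\<^sub>R e) = 0) (nhds (0::real))"
        by (rule eventually_mono) (use Cons in auto)
      then have "deriv (\<lambda>t. iter_partial bs \<psi> (x + t *\<^sub>R e)) 0 = deriv (\<lambda>_. 0) (0::real)"
        by (intro deriv_cong_ev) auto
      then show ?thesis by simp
    qed
    then show ?case by blast
  qed
  then have sub: "closure {x. iter_partial bs \<psi> x \<noteq> 0} \<subseteq> closure {x. \<psi> x \<noteq> 0}"
    by (simp add: closure_minimal)
  moreover have "compact (closure {x. iter_partial bs \<psi> x \<noteq> 0})"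
    using assms(1) sub compact_Int_closed[of "closure {x. \<psi> x \<noteq> 0}" "closure {x. iter_partial bs \<psi> x \<noteq> 0}"]
    unfolding test_function_def by (simp add: inf_absorb2)
  ultimately show ?thesis
    using assms smooth_function_iter_partial unfolding test_function_def by blast
qed

lemma test_function_bounded_support:
  assumes "test_function \<Omega> \<psi>"
  obtains R where "R > 0" "\<And>x. norm x > R \<Longrightarrow> \<psi> x = 0"
proof -
  have "bounded {x. \<psi> x \<noteq> 0}"
    using assms unfolding test_function_def
    by (meson bounded_subset closure_subset compact_imp_bounded)
  then obtain R where "R > 0" "\<forall>x\<in>{x. \<psi> x \<noteq> 0}. norm x \<le> R"
    using bounded_pos by blast
  then show ?thesis using that by force
qed

lemma test_function_outside: "test_function \<Omega> \<psi> \<Longrightarrow> x \<notin> \<Omega> \<Longrightarrow> \<psi> x = 0"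
  unfolding test_function_def using closure_subset[of "{x. \<psi> x \<noteq> 0}"] by blast

lemma test_function_bounded:
  assumes "test_function \<Omega> \<psi>"
  obtains M where "M \<ge> 0" "\<And>x. \<bar>\<psi> x\<bar> \<le> M"
proof -
  obtain R where R: "R > 0" "\<And>x. norm x > R \<Longrightarrow> \<psi> x = 0"
    using test_function_bounded_support[OF assms] by blast
  have "continuous_on (cball 0 R) \<psi>"
    using assms smooth_function_continuous continuous_on_subset unfolding test_function_def by blast
  then have "bounded (\<psi> ` cball 0 R)"
    by (intro compact_imp_bounded compact_continuous_image) auto
  then obtain M where M: "M > 0" "\<forall>y\<in>\<psi> ` cball 0 R. norm y \<le> M"
    using bounded_pos by blast
  have "\<bar>\<psi> x\<bar> \<le> M" for x
    using M R(2)[of x] by (cases "norm x \<le> R") auto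
  then show ?thesis using M that[of M] by auto
qed

text \<open>The factor \<open>a\<close> makes room for the affine substitution that turns the restriction of a ridge
  function to a line into its profile.\<close>

lemma test_function_line:
  fixes G :: "'a::euclidean_space \<Rightarrow> real"
  assumes G: "test_function \<Omega> G" and e: "e \<in> Basis" and a: "a \<noteq> 0"
  shows "test_function UNIV (\<lambda>s::real. G (x + (a * s) *\<^sub>R e))"
proof -
  obtain R where R: "R > 0" "\<And>x. norm x > R \<Longrightarrow> G x = 0"
    using test_function_bounded_support[OF G] by blast
  have "\<bar>s\<bar> \<le> (R + norm x) / \<bar>a\<bar>" if "G (x + (a * s) *\<^sub>R e) \<noteq> 0" for s
  proof -
    have "norm (x + (a * s) *\<^sub>R e) \<le> R" using that R(2) by force
    moreover have "norm ((a * s) *\<^sub>R e) \<le> norm (x + (a * s) *\<^sub>R e) + norm x"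
      using norm_triangle_ineq4[of "x + (a * s) *\<^sub>R e" x] by simp
    ultimately have "\<bar>a\<bar> * \<bar>s\<bar> \<le> R + norm x"
      using e by (simp add: abs_mult)
    then show ?thesis using a by (simp add: field_simps)
  qed
  then have "bounded {s. G (x + (a * s) *\<^sub>R e) \<noteq> 0}"
    unfolding bounded_real by blast
  then show ?thesis
    using G e smooth_function_line unfolding test_function_def by (auto simp: compact_closure)
qed

text \<open>The list chosen in \<open>mi_partial\<close> fixes an order of differentiation; all that matters about it is
  which basis vectors it repeats how often.\<close>

lemma mi_partial_list:
  fixes \<alpha> :: "'a::euclidean_space \<Rightarrow> nat"
  obtains bs where "mi_partial \<alpha> = iter_partial bs" "set bs \<subseteq> Basis" "length bs = mi_order \<alpha>"
    "\<forall>w. prod_list (map (\<lambda>e. w \<bullet> e) bs) = mi_power w \<alpha>"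
proof -
  let ?P = "\<lambda>bs. set bs \<subseteq> Basis \<and> (\<forall>b\<in>Basis. count_list bs b = \<alpha> b)"
  have ex: "\<exists>bs. set bs \<subseteq> S \<and> (\<forall>b\<in>S. count_list bs b = \<alpha> b)" if "finite S" for S :: "'a set"
    using that
  proof induction
    case (insert b S)
    then obtain bs where bs: "set bs \<subseteq> S" "\<forall>b\<in>S. count_list bs b = \<alpha> b" by blast
    have rep: "count_list (replicate n b) c = (if c = b then n else 0)" for n c
      by (induction n) auto
    have "count_list bs b = 0" using bs insert by (auto simp: count_list_0_iff)
    then have "\<forall>c\<in>insert b S. count_list (replicate (\<alpha> b) b @ bs) c = \<alpha> c"
      using bs(2) insert(2) by (auto simp: rep)
    moreover have "set (replicate (\<alpha> b) b @ bs) \<subseteq> insert b S" using bs by auto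
    ultimately show ?case by blast
  qed simp
  define bs where "bs = (SOME bs. ?P bs)"
  have bs: "?P bs"
    unfolding bs_def by (rule someI_ex) (use ex[OF finite_Basis] in blast)
  have prod: "prod_list (map f xs) = (\<Prod>b\<in>S. f b ^ count_list xs b)"
    if "finite S" "set xs \<subseteq> S" for f :: "'a \<Rightarrow> real" and xs S
    using that(2)
  proof (induction xs)
    case (Cons y xs)
    have "(\<Prod>b\<in>S. f b ^ count_list (y # xs) b) = (\<Prod>b\<in>S. (if b = y then f b else 1) * f b ^ count_list xs b)"
      by (intro prod.cong) auto
    also have "\<dots> = f y * (\<Prod>b\<in>S. f b ^ count_list xs b)"
      using Cons.prems that(1) by (simp add: prod.distrib prod.delta)
    finally show ?case using Cons by simp
  qed simp
  have "length bs = mi_order \<alpha>"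
    using sum_count_set[of bs Basis] bs by (simp add: mi_order_def)
  moreover have "prod_list (map (\<lambda>e. w \<bullet> e) bs) = mi_power w \<alpha>" for w
    using prod[OF finite_Basis, of bs] bs by (simp add: mi_power_def)
  moreover have "mi_partial \<alpha> = iter_partial bs"
    by (simp add: mi_partial_def bs_def)
  ultimately show ?thesis using that bs by blast
qed

lemma mi_partial_real: "mi_partial (\<lambda>_::real. m) = iter_partial (replicate m 1)"
proof (rule mi_partial_list[of "\<lambda>_::real. m"])
  fix bs :: "real list"
  assume "mi_partial (\<lambda>_::real. m) = iter_partial bs" "set bs \<subseteq> Basis"
    "length bs = mi_order (\<lambda>_::real. m)"
  then show ?thesis using list_over_Basis_real[of bs] by (simp add: mi_order_def)
qed

text \<open>Testing the higher derivative against \<open>\<psi>\<close> and the lower one against \<open>\<psi>'\<close> involves the same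
  integral of \<open>\<sigma>\<close> against the derivative of \<open>\<psi>\<close> of order \<open>Suc m\<close>.\<close>

lemma weak_deriv_successive:
  fixes \<sigma> u v :: "real \<Rightarrow> complex"
  assumes u: "has_weak_deriv UNIV (\<lambda>_. m) \<sigma> u" and v: "has_weak_deriv UNIV (\<lambda>_. Suc m) \<sigma> v"
    and \<psi>: "test_function UNIV \<psi>"
  shows "(LINT s|lebesgue. iter_partial [1] \<psi> s *\<^sub>R u s) = - (LINT s|lebesgue. \<psi> s *\<^sub>R v s)"
proof -
  have "test_function UNIV (iter_partial [1] \<psi>)"
    using \<psi> by (intro test_function_iter_partial) auto
  then have "(LINT x|lebesgue. iter_partial (replicate m 1) (iter_partial [1] \<psi>) x *\<^sub>R \<sigma> x)
      = (- 1) ^ m * (LINT x|lebesgue. iter_partial [1] \<psi> x *\<^sub>R u x)"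
    using u by (simp add: has_weak_deriv_def mi_partial_real mi_order_def set_lebesgue_integral_def)
  moreover have "(LINT x|lebesgue. iter_partial (replicate (Suc m) 1) \<psi> x *\<^sub>R \<sigma> x)
      = (- 1) ^ Suc m * (LINT x|lebesgue. \<psi> x *\<^sub>R v x)"
    using v \<psi> by (simp add: has_weak_deriv_def mi_partial_real mi_order_def set_lebesgue_integral_def
        del: replicate_Suc iter_partial.simps)
  moreover have "iter_partial (replicate (Suc m) 1) \<psi> = iter_partial (replicate m 1) (iter_partial [1] \<psi>)"
    by (simp only: replicate_append_same[symmetric] replicate_Suc iter_partial_append)
  ultimately have "(- 1) ^ m * (LINT x|lebesgue. iter_partial [1] \<psi> x *\<^sub>R u x)
      = (- 1) ^ m * (- (LINT x|lebesgue. \<psi> x *\<^sub>R v x))"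
    by (simp only: power_Suc mult_minus_left mult_minus_right mult_1_left)
  then show ?thesis
    by (subst (asm) mult_cancel_left) simp
qed

section \<open>Integration along lines in a coordinate direction\<close>

text \<open>Fubini's theorem in the direction \<open>e\<close> without splitting the space: each line in that direction
  meets the slab \<open>0 \<le> x \<bullet> e \<le> 1\<close> in a segment of unit length, so averaging over the
  slab counts each line once.\<close>

lemma nn_integral_lines:
  fixes f :: "'a::euclidean_space \<Rightarrow> ennreal"
  assumes f[measurable]: "f \<in> borel_measurable borel" and e: "e \<in> Basis"
  shows "(\<integral>\<^sup>+x. f x \<partial>lborel) = (\<integral>\<^sup>+x. indicator {x. 0 \<le> x \<bullet> e \<and> x \<bullet> e \<le> 1} x *
    (\<integral>\<^sup>+t. f (x + t *\<^sub>R e) \<partial>lborel) \<partial>(lborel :: 'a measure))"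
proof -
  let ?S = "{x::'a. 0 \<le> x \<bullet> e \<and> x \<bullet> e \<le> 1}"
  let ?\<chi> = "indicator ?S :: 'a \<Rightarrow> ennreal"
  have [measurable]: "?S \<in> sets borel"
    by (intro borel_closed closed_Collect_conj closed_Collect_le) (auto intro!: continuous_intros)
  have shift: "(\<integral>\<^sup>+x. g x \<partial>lborel) = (\<integral>\<^sup>+x. g (x + c) \<partial>lborel)"
    if [measurable]: "g \<in> borel_measurable borel" for g :: "'a \<Rightarrow> ennreal" and c
  proof -
    have "(\<integral>\<^sup>+x. g x \<partial>lborel) = (\<integral>\<^sup>+x. g x \<partial>distr lborel borel ((+) c))"
      by (simp only: lborel_distr_plus)
    also have "\<dots> = (\<integral>\<^sup>+x. g (c + x) \<partial>lborel)"
      by (subst nn_integral_distr) auto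
    finally show ?thesis by (simp add: add.commute)
  qed
  have segment: "(\<integral>\<^sup>+t. ?\<chi> (x - t *\<^sub>R e) \<partial>lborel) = 1" for x
  proof -
    have "(\<integral>\<^sup>+t. ?\<chi> (x - t *\<^sub>R e) \<partial>lborel) = (\<integral>\<^sup>+t. indicator {x \<bullet> e - 1 .. x \<bullet> e} t \<partial>lborel)"
      using e by (intro nn_integral_cong) (auto simp: indicator_def inner_diff_left)
    then show ?thesis by simp
  qed
  have "(\<integral>\<^sup>+x. ?\<chi> x * (\<integral>\<^sup>+t. f (x + t *\<^sub>R e) \<partial>lborel) \<partial>lborel)
      = (\<integral>\<^sup>+x. (\<integral>\<^sup>+t. ?\<chi> x * f (x + t *\<^sub>R e) \<partial>lborel) \<partial>lborel)"
    by (intro nn_integral_cong nn_integral_cmult[symmetric]) measurable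
  also have "\<dots> = (\<integral>\<^sup>+t. (\<integral>\<^sup>+x. ?\<chi> x * f (x + t *\<^sub>R e) \<partial>lborel) \<partial>lborel)"
    using lborel_pair.Fubini[of "\<lambda>(x, t). ?\<chi> x * f (x + t *\<^sub>R e)"] by simp
  also have "\<dots> = (\<integral>\<^sup>+t. (\<integral>\<^sup>+x. ?\<chi> (x - t *\<^sub>R e) * f x \<partial>lborel) \<partial>lborel)"
  proof (rule nn_integral_cong)
    fix t :: real
    show "(\<integral>\<^sup>+x. ?\<chi> x * f (x + t *\<^sub>R e) \<partial>lborel) = (\<integral>\<^sup>+x. ?\<chi> (x - t *\<^sub>R e) * f x \<partial>lborel)"
      using shift[of "\<lambda>x. ?\<chi> (x - t *\<^sub>R e) * f x" "t *\<^sub>R e"] by simp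
  qed
  also have "\<dots> = (\<integral>\<^sup>+x. (\<integral>\<^sup>+t. ?\<chi> (x - t *\<^sub>R e) * f x \<partial>lborel) \<partial>lborel)"
    using lborel_pair.Fubini[of "\<lambda>(x, t). ?\<chi> (x - t *\<^sub>R e) * f x"] by simp
  also have "\<dots> = (\<integral>\<^sup>+x. f x \<partial>lborel)"
    by (simp add: nn_integral_multc segment)
  finally show ?thesis ..
qed

lemma enn2real_eq_iff_finite:
  "a \<noteq> top \<Longrightarrow> b \<noteq> top \<Longrightarrow> enn2real a = enn2real b \<longleftrightarrow> a = b"
  by (metis ennreal_enn2real_if)

text \<open>On each line the positive and the negative part of \<open>F\<close> have the same finite integral, so the same
  holds after averaging over the lines.\<close>

lemma integral_zero_if_lines_zero_real:
  fixes F :: "'a::euclidean_space \<Rightarrow> real"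
  assumes F: "integrable lborel F" and e: "e \<in> Basis"
    and int: "\<And>x. integrable lborel (\<lambda>t. F (x + t *\<^sub>R e))"
    and zero: "\<And>x. (LINT t|lborel. F (x + t *\<^sub>R e)) = 0"
  shows "(LINT x|lborel. F x) = 0"
proof -
  have [measurable]: "F \<in> borel_measurable borel" using F by simp
  have "(\<integral>\<^sup>+t. ennreal (F (x + t *\<^sub>R e)) \<partial>lborel) = (\<integral>\<^sup>+t. ennreal (- F (x + t *\<^sub>R e)) \<partial>lborel)" for x
    using zero[of x] int[of x]
    by (simp add: real_lebesgue_integral_def real_integrable_def enn2real_eq_iff_finite less_top)
  then have "(\<integral>\<^sup>+x. ennreal (F x) \<partial>lborel) = (\<integral>\<^sup>+x. ennreal (- F x) \<partial>lborel)"
    by (subst (1 2) nn_integral_lines[OF _ e]) auto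
  then show ?thesis by (simp add: real_lebesgue_integral_def[OF F])
qed

lemma integral_zero_if_lines_zero:
  fixes F :: "'a::euclidean_space \<Rightarrow> complex"
  assumes F: "integrable lborel F" and e: "e \<in> Basis"
    and int: "\<And>x. integrable lborel (\<lambda>t. F (x + t *\<^sub>R e))"
    and zero: "\<And>x. (LINT t|lborel. F (x + t *\<^sub>R e)) = 0"
  shows "(LINT x|lborel. F x) = 0"
proof (rule complex_eqI)
  show "Re (LINT x|lborel. F x) = Re 0"
    using integral_zero_if_lines_zero_real[OF integrable_Re[OF F] e integrable_Re[OF int]]
    by (simp add: F int zero)
  show "Im (LINT x|lborel. F x) = Im 0"
    using integral_zero_if_lines_zero_real[OF integrable_Im[OF F] e integrable_Im[OF int]]
    by (simp add: F int zero)
qed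

text \<open>If \<open>w \<bullet> e \<noteq> 0\<close>, every line in the direction \<open>e\<close> is mapped affinely and bijectively onto the real
  line by \<open>x \<mapsto> w \<bullet> x + b\<close>, and so meets the preimage of a null set in a null set.\<close>

lemma AE_ridge:
  fixes w :: "'a::euclidean_space"
  assumes Q: "AE s in lborel. Q s" and w: "w \<noteq> 0"
  shows "AE x in lborel. Q (w \<bullet> x + b)"
proof -
  obtain N where N: "{s \<in> space lborel. \<not> Q s} \<subseteq> N" "N \<in> sets lborel" "emeasure lborel N = 0"
    using Q by (auto elim: AE_E)
  then have [measurable]: "N \<in> sets borel" by simp
  obtain e where e: "e \<in> Basis" "w \<bullet> e \<noteq> 0"
    using w by (metis euclidean_all_zero_iff)
  have line: "(\<integral>\<^sup>+t. indicator N (w \<bullet> (x + t *\<^sub>R e) + b) \<partial>lborel) = (0::ennreal)" for x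
  proof -
    have "\<bar>w \<bullet> e\<bar> * (\<integral>\<^sup>+t. indicator N ((w \<bullet> x + b) + (w \<bullet> e) * t) \<partial>lborel) = (\<integral>\<^sup>+s. indicator N s \<partial>lborel)"
      using e(2) by (intro nn_integral_real_affine[symmetric]) auto
    also have "\<dots> = 0" using N by simp
    finally show ?thesis using e(2) by (simp add: inner_add_right algebra_simps)
  qed
  let ?M = "{x. w \<bullet> x + b \<in> N}"
  have [measurable]: "?M \<in> sets borel" by measurable
  have "(\<lambda>x. indicator N (w \<bullet> x + b)) = (indicator ?M :: 'a \<Rightarrow> ennreal)"
    by (auto simp: indicator_def fun_eq_iff)
  then have "emeasure lborel ?M = (\<integral>\<^sup>+x. indicator N (w \<bullet> x + b) \<partial>lborel)"
    by simp
  also have "\<dots> = 0"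
    by (subst nn_integral_lines[OF _ e(1)]) (auto simp: line)
  finally have "?M \<in> null_sets lborel" by auto
  then show ?thesis
    using N(1) by (intro AE_I'[of ?M]) auto
qed

section \<open>The chain rule for ridge functions\<close>

definition locally_bounded :: "(real \<Rightarrow> complex) \<Rightarrow> bool" where
  "locally_bounded h \<longleftrightarrow> (\<forall>R. \<exists>M. \<forall>s. \<bar>s\<bar> \<le> R \<longrightarrow> cmod (h s) \<le> M)"

lemma integrable_bounded_support:
  fixes f :: "'a::euclidean_space \<Rightarrow> complex"
  assumes [measurable]: "f \<in> borel_measurable borel"
    and supp: "\<And>x. norm x > R \<Longrightarrow> f x = 0" and bound: "\<And>x. norm x \<le> R \<Longrightarrow> cmod (f x) \<le> M"
  shows "integrable lborel f"
proof (rule Bochner_Integration.integrable_bound)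
  show "integrable lborel (\<lambda>x. M * indicator (cball 0 R) x :: real)"
    by (intro integrable_mult_right integrable_real_indicator emeasure_bounded_finite) auto
  show "AE x in lborel. cmod (f x) \<le> norm (M * indicator (cball 0 R) x :: real)"
    using supp bound by (intro AE_I2) (force simp: indicator_def not_le)
qed simp

lemma integrable_test_function_ridge:
  fixes \<psi> :: "'a::euclidean_space \<Rightarrow> real"
  assumes \<psi>: "test_function \<Omega> \<psi>" and [measurable]: "h \<in> borel_measurable borel"
    and h: "locally_bounded h"
  shows "integrable lborel (\<lambda>x. \<psi> x *\<^sub>R h (w \<bullet> x + b))"
proof -
  obtain R where R: "R > 0" "\<And>x. norm x > R \<Longrightarrow> \<psi> x = 0"
    using test_function_bounded_support[OF \<psi>] by blast
  obtain N where N: "N \<ge> 0" "\<And>x. \<bar>\<psi> x\<bar> \<le> N"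
    using test_function_bounded[OF \<psi>] by blast
  obtain M where M: "\<And>s. \<bar>s\<bar> \<le> norm w * R + \<bar>b\<bar> \<Longrightarrow> cmod (h s) \<le> M"
    using h unfolding locally_bounded_def by blast
  have [measurable]: "\<psi> \<in> borel_measurable borel"
    using \<psi> smooth_function_borel unfolding test_function_def by blast
  show ?thesis
  proof (rule integrable_bounded_support[of _ R "N * M"])
    fix x :: 'a assume x: "norm x \<le> R"
    have "\<bar>w \<bullet> x\<bar> \<le> norm w * R"
      using Cauchy_Schwarz_ineq2[of w x] x by (meson mult_left_mono norm_ge_zero order_trans)
    then have "cmod (h (w \<bullet> x + b)) \<le> M" by (intro M) linarith
    then show "cmod (\<psi> x *\<^sub>R h (w \<bullet> x + b)) \<le> N * M"
      using N by (auto intro!: mult_mono)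
  qed (use R in auto)
qed

lemma integral_line_derivative_zero:
  fixes \<psi> :: "'a::euclidean_space \<Rightarrow> real"
  assumes \<psi>: "test_function \<Omega> \<psi>" and e: "e \<in> Basis"
  shows "(LINT t|lborel. iter_partial [e] \<psi> (x + t *\<^sub>R e)) = 0"
proof -
  obtain R where R: "R > 0" "\<And>x. norm x > R \<Longrightarrow> \<psi> x = 0"
    using test_function_bounded_support[OF \<psi>] by blast
  have \<psi>': "test_function \<Omega> (iter_partial [e] \<psi>)"
    using \<psi> e by (intro test_function_iter_partial) auto
  obtain R' where R': "R' > 0" "\<And>x. norm x > R' \<Longrightarrow> iter_partial [e] \<psi> x = 0"
    using test_function_bounded_support[OF \<psi>'] by blast
  define S where "S = max R R' + norm x + 1"
  have S: "S \<ge> 0" using R(1) norm_ge_zero[of x] unfolding S_def by linarith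
  have far: "norm (x + t *\<^sub>R e) > max R R'" if "\<bar>t\<bar> \<ge> S" for t
  proof -
    have "norm (t *\<^sub>R e) \<le> norm (x + t *\<^sub>R e) + norm x"
      using norm_triangle_ineq4[of "x + t *\<^sub>R e" x] by simp
    then have "\<bar>t\<bar> \<le> norm (x + t *\<^sub>R e) + norm x" using e by simp
    then show ?thesis using that unfolding S_def by linarith
  qed
  have sm: "smooth_function \<psi>" using \<psi> by (simp add: test_function_def)
  have sm': "smooth_function (iter_partial [e] \<psi>)" using \<psi>' by (simp add: test_function_def)
  have cont: "isCont (\<lambda>t. iter_partial [e] \<psi> (x + t *\<^sub>R e)) t" for t
    using smooth_function_line_derivative[OF sm'] by (rule DERIV_isCont)
  have "has_bochner_integral lborel
      (\<lambda>t. iter_partial [e] \<psi> (x + t *\<^sub>R e) * indicator {- S .. S} t) (\<psi> (x + S *\<^sub>R e) - \<psi> (x + (- S) *\<^sub>R e))"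
    using S by (intro has_bochner_integral_FTC_Icc_real smooth_function_line_derivative[OF sm] cont) simp
  moreover have "iter_partial [e] \<psi> (x + t *\<^sub>R e) * indicator {- S .. S} t = iter_partial [e] \<psi> (x + t *\<^sub>R e)" for t
    using far[of t] R'(2)[of "x + t *\<^sub>R e"] by (cases "\<bar>t\<bar> \<ge> S") (auto simp: indicator_def)
  moreover have "\<psi> (x + S *\<^sub>R e) = 0" "\<psi> (x + (- S) *\<^sub>R e) = 0"
    using far[of S] far[of "- S"] S by (auto intro!: R(2))
  ultimately have "has_bochner_integral lborel (\<lambda>t. iter_partial [e] \<psi> (x + t *\<^sub>R e)) 0"
    by (simp only: diff_self)
  then show ?thesis by (rule has_bochner_integral_integral_eq)
qed

text \<open>The first-order weak derivative on the real line, tested with Borel rather than Lebesgue measure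
  so that Fubini's theorem is available.\<close>

definition weak_deriv_1 :: "(real \<Rightarrow> complex) \<Rightarrow> (real \<Rightarrow> complex) \<Rightarrow> bool" where
  "weak_deriv_1 h h' \<longleftrightarrow> (\<forall>\<psi>. test_function UNIV \<psi> \<longrightarrow>
     (LINT s|lborel. iter_partial [1] \<psi> s *\<^sub>R h s) = - (LINT s|lborel. \<psi> s *\<^sub>R h' s))"

text \<open>On a line in the direction \<open>e\<close> with \<open>w \<bullet> e \<noteq> 0\<close>, the ridge profile is an affine
  reparametrization of \<open>h\<close>, and the restriction of \<open>\<psi>\<close> becomes a test function of the real variable:
  the definition of the weak derivative of \<open>h\<close> applies on each line. If
  \<open>w \<bullet> e = 0\<close>, the ridge function is constant on the line, and the derivative of \<open>\<psi>\<close> along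
  the line integrates to zero.\<close>

lemma ridge_partial:
  fixes \<psi> :: "'a::euclidean_space \<Rightarrow> real"
  assumes \<psi>: "test_function \<Omega> \<psi>" and e: "e \<in> Basis"
    and h: "h \<in> borel_measurable borel" "locally_bounded h"
    and h': "h' \<in> borel_measurable borel" "locally_bounded h'"
    and weak: "weak_deriv_1 h h'"
  shows "(LINT x|lborel. iter_partial [e] \<psi> x *\<^sub>R h (w \<bullet> x + b))
    = - ((w \<bullet> e) *\<^sub>R (LINT x|lborel. \<psi> x *\<^sub>R h' (w \<bullet> x + b)))"
proof -
  note [measurable] = h(1) h'(1)
  have \<psi>': "test_function \<Omega> (iter_partial [e] \<psi>)"
    using \<psi> e by (intro test_function_iter_partial) auto
  define F where "F x = iter_partial [e] \<psi> x *\<^sub>R h (w \<bullet> x + b) + (w \<bullet> e) *\<^sub>R (\<psi> x *\<^sub>R h' (w \<bullet> x + b))" for x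
  have i1: "integrable lborel (\<lambda>x. iter_partial [e] \<psi> x *\<^sub>R h (w \<bullet> x + b))"
    by (rule integrable_test_function_ridge[OF \<psi>' h])
  have i2: "integrable lborel (\<lambda>x. (w \<bullet> e) *\<^sub>R (\<psi> x *\<^sub>R h' (w \<bullet> x + b)))"
    by (intro integrable_scaleR_right integrable_test_function_ridge[OF \<psi> h'])
  have line: "integrable lborel (\<lambda>t. F (x + t *\<^sub>R e)) \<and> (LINT t|lborel. F (x + t *\<^sub>R e)) = 0" for x
  proof -
    have t\<psi>: "test_function UNIV (\<lambda>t::real. G (y + (a * t) *\<^sub>R e))"
      if "test_function \<Omega> G" "a \<noteq> 0" for G a y
      using that e by (intro test_function_line)
    have gen: "integrable lborel (\<lambda>t::real. G (x + t *\<^sub>R e) *\<^sub>R k ((w \<bullet> e) * t + (w \<bullet> x + b)))"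
      if "test_function \<Omega> G" "k \<in> borel_measurable borel" "locally_bounded k" for G k
      using integrable_test_function_ridge[OF t\<psi>[OF that(1), of 1 x] that(2,3), of "w \<bullet> e" "w \<bullet> x + b"]
      by simp
    note int = gen[OF \<psi>' h] gen[OF \<psi> h']
    have F: "F (x + t *\<^sub>R e) = iter_partial [e] \<psi> (x + t *\<^sub>R e) *\<^sub>R h ((w \<bullet> e) * t + (w \<bullet> x + b))
        + (w \<bullet> e) *\<^sub>R (\<psi> (x + t *\<^sub>R e) *\<^sub>R h' ((w \<bullet> e) * t + (w \<bullet> x + b)))" for t
      unfolding F_def by (simp add: inner_add_right algebra_simps)
    have "integrable lborel (\<lambda>t. F (x + t *\<^sub>R e))"
      unfolding F by (intro Bochner_Integration.integrable_add integrable_scaleR_right int)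
    moreover have "(LINT t|lborel. F (x + t *\<^sub>R e)) = 0"
    proof (cases "w \<bullet> e = 0")
      case True
      have "integrable lborel (\<lambda>t. Re (iter_partial [e] \<psi> (x + t *\<^sub>R e) *\<^sub>R 1))"
        by (intro integrable_Re gen[OF \<psi>', of "\<lambda>_. 1"]) (auto simp: locally_bounded_def)
      then have "(LINT t|lborel. iter_partial [e] \<psi> (x + t *\<^sub>R e) *\<^sub>R h (w \<bullet> x + b)) = 0"
        using integral_line_derivative_zero[OF \<psi> e, of x]
        by (subst integral_scaleR_left) (simp_all del: iter_partial.simps)
      then show ?thesis
        using True unfolding F by (simp del: iter_partial.simps)
    next
      case False
      \<comment> \<open>The substitution is \<open>s = w \<bullet> (x + t *\<^sub>R e) + b\<close>, and \<open>y\<close> is the point of the line with \<open>s = 0\<close>.\<close>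
      define y where "y = x - ((w \<bullet> x + b) / (w \<bullet> e)) *\<^sub>R e"
      define \<theta> where "\<theta> s = \<psi> (y + (inverse (w \<bullet> e) * s) *\<^sub>R e)" for s
      have \<theta>: "test_function UNIV \<theta>"
        unfolding \<theta>_def using False by (intro t\<psi>[OF \<psi>]) auto
      then have \<theta>': "test_function UNIV (iter_partial [1] \<theta>)"
        by (intro test_function_iter_partial) auto
      have d\<theta>: "iter_partial [1] \<theta> s = inverse (w \<bullet> e) * iter_partial [e] \<psi> (y + (inverse (w \<bullet> e) * s) *\<^sub>R e)" for s
        using iter_partial_line[of \<psi> e 1 y "inverse (w \<bullet> e)"] \<psi> e
        unfolding \<theta>_def test_function_def by (simp add: fun_eq_iff)
      define K where "K s = iter_partial [1] \<theta> s *\<^sub>R h s + \<theta> s *\<^sub>R h' s" for s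
      have pt: "y + (inverse (w \<bullet> e) * ((w \<bullet> x + b) + (w \<bullet> e) * t)) *\<^sub>R e = x + t *\<^sub>R e" for t
      proof -
        have "inverse (w \<bullet> e) * ((w \<bullet> x + b) + (w \<bullet> e) * t) = (w \<bullet> x + b) / (w \<bullet> e) + t"
          using False by (simp add: field_simps)
        then show ?thesis unfolding y_def by (simp only: scaleR_left_distrib) simp
      qed
      have FK: "F (x + t *\<^sub>R e) = (w \<bullet> e) *\<^sub>R K ((w \<bullet> x + b) + (w \<bullet> e) * t)" for t
      proof -
        have "\<theta> ((w \<bullet> x + b) + (w \<bullet> e) * t) = \<psi> (x + t *\<^sub>R e)"
          unfolding \<theta>_def pt ..
        moreover have "(w \<bullet> e) * (inverse (w \<bullet> e) * r) = r" for r
          using False by simp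
        moreover have "(w \<bullet> e) * t + (w \<bullet> x + b) = (w \<bullet> x + b) + (w \<bullet> e) * t" by simp
        ultimately show ?thesis
          unfolding F K_def d\<theta> pt by (simp only: scaleR_add_right scaleR_scaleR)
      qed
      have "integrable lborel (\<lambda>s. iter_partial [1] \<theta> s *\<^sub>R h s)" "integrable lborel (\<lambda>s. \<theta> s *\<^sub>R h' s)"
        using integrable_test_function_ridge[OF \<theta>' h, of 1 0]
          integrable_test_function_ridge[OF \<theta> h', of 1 0] by simp_all
      then have "(LINT s|lborel. K s) = 0"
        using weak \<theta> unfolding K_def weak_deriv_1_def by simp
      then have "(LINT t|lborel. K ((w \<bullet> x + b) + (w \<bullet> e) * t)) = 0"
        using lborel_integral_real_affine[OF False, of K "w \<bullet> x + b"] False by simp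
      then show ?thesis unfolding FK by simp
    qed
    ultimately show ?thesis by blast
  qed
  have "(LINT x|lborel. F x) = 0"
  proof (rule integral_zero_if_lines_zero[OF _ e])
    show "integrable lborel F"
      unfolding F_def by (intro Bochner_Integration.integrable_add i1 i2)
  qed (use line in auto)
  moreover have "(LINT x|lborel. F x) = (LINT x|lborel. iter_partial [e] \<psi> x *\<^sub>R h (w \<bullet> x + b))
      + (w \<bullet> e) *\<^sub>R (LINT x|lborel. \<psi> x *\<^sub>R h' (w \<bullet> x + b))"
    unfolding F_def using i1 i2 integrable_test_function_ridge[OF \<psi> h', of w b]
    by (simp only: Bochner_Integration.integral_add integral_scaleR_right)
  ultimately show ?thesis by (simp add: eq_neg_iff_add_eq_0)
qed

text \<open>The induction moves one derivative at a time from the test function to the profile, the outermost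
  first.\<close>

lemma ridge_iter_partial:
  fixes \<psi> :: "'a::euclidean_space \<Rightarrow> real" and h :: "nat \<Rightarrow> real \<Rightarrow> complex"
  assumes \<psi>: "test_function \<Omega> \<psi>" and bs: "set bs \<subseteq> Basis" "m + length bs \<le> k"
    and h: "\<And>m. m \<le> k \<Longrightarrow> h m \<in> borel_measurable borel \<and> locally_bounded (h m)"
    and weak: "\<And>m. m < k \<Longrightarrow> weak_deriv_1 (h m) (h (Suc m))"
  shows "(LINT x|lborel. iter_partial bs \<psi> x *\<^sub>R h m (w \<bullet> x + b))
    = ((- 1) ^ length bs * prod_list (map (\<lambda>e. w \<bullet> e) bs)) *\<^sub>R
      (LINT x|lborel. \<psi> x *\<^sub>R h (m + length bs) (w \<bullet> x + b))"
  using bs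
proof (induction bs arbitrary: m)
  case (Cons e bs)
  have t: "test_function \<Omega> (iter_partial bs \<psi>)"
    using Cons.prems by (intro test_function_iter_partial[OF \<psi>]) auto
  have "iter_partial (e # bs) \<psi> = iter_partial [e] (iter_partial bs \<psi>)" by simp
  then have "(LINT x|lborel. iter_partial (e # bs) \<psi> x *\<^sub>R h m (w \<bullet> x + b))
    = - ((w \<bullet> e) *\<^sub>R (LINT x|lborel. iter_partial bs \<psi> x *\<^sub>R h (Suc m) (w \<bullet> x + b)))"
    using ridge_partial[OF t, of e "h m" "h (Suc m)" w b] Cons.prems h[of m] h[of "Suc m"] weak[of m]
    by simp
  then show ?case
    using Cons.IH[of "Suc m"] Cons.prems by simp
qed simp

section \<open>Superpositions of kernels\<close>

lemma complex_integral_mult_right: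
  "complex_integral \<rho> (\<lambda>p. c * g p) = c * complex_integral \<rho> g"
  by (simp add: complex_integral_jordan_parts algebra_simps)

lemma finite_measure_jordan_parts:
  assumes \<rho>: "complex_measure \<rho>" and fin: "emeasure (total_variation \<rho>) UNIV < \<infinity>"
    and P: "P \<in> jordan_parts \<rho>"
  shows "finite_measure P"
proof
  have "emeasure P UNIV \<le> emeasure (total_variation \<rho>) UNIV"
    using jordan_parts_le[OF \<rho> P] sets_jordan_parts[OF P] by (subst (asm) le_measure) auto
  then show "emeasure P (space P) \<noteq> \<infinity>"
    using fin space_jordan_parts[OF P] by auto
qed

lemma borel_measurable_complex_integral:
  fixes K :: "'a::euclidean_space \<Rightarrow> 'b::second_countable_topology \<Rightarrow> complex"
  assumes \<rho>: "complex_measure \<rho>" and fin: "emeasure (total_variation \<rho>) UNIV < \<infinity>"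
    and K: "(\<lambda>(x, p). K x p) \<in> borel_measurable (borel \<Otimes>\<^sub>M borel)"
  shows "(\<lambda>x. complex_integral \<rho> (K x)) \<in> borel_measurable borel"
proof -
  have [measurable]: "(\<lambda>x. integral\<^sup>L P (K x)) \<in> borel_measurable borel" if P: "P \<in> jordan_parts \<rho>" for P
  proof -
    interpret finite_measure P by (rule finite_measure_jordan_parts[OF \<rho> fin P])
    have "sets (borel \<Otimes>\<^sub>M P) = sets (borel \<Otimes>\<^sub>M borel :: ('a \<times> 'b) measure)"
      using sets_jordan_parts[OF P] by (intro sets_pair_measure_cong) auto
    then have "(\<lambda>(x, p). K x p) \<in> borel_measurable (borel \<Otimes>\<^sub>M P)"
      using K by (simp cong: measurable_cong_sets)
    then show ?thesis by (rule borel_measurable_lebesgue_integral)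
  qed
  show ?thesis
    unfolding complex_integral_jordan_parts
    by (intro borel_measurable_add borel_measurable_diff borel_measurable_times borel_measurable_const
        \<open>\<And>P. P \<in> jordan_parts \<rho> \<Longrightarrow> (\<lambda>x. integral\<^sup>L P (K x)) \<in> borel_measurable borel\<close> jordan_parts_mem)
qed

text \<open>On the product with each of the four parts, \<open>\<bar>u x\<bar> * B p\<close> is an integrable majorant.\<close>

lemma complex_integral_Fubini:
  fixes K :: "'a::euclidean_space \<Rightarrow> 'b::second_countable_topology \<Rightarrow> complex"
  assumes \<rho>: "complex_measure \<rho>" and fin: "emeasure (total_variation \<rho>) UNIV < \<infinity>"
    and K: "(\<lambda>(x, p). K x p) \<in> borel_measurable (borel \<Otimes>\<^sub>M borel)"
    and B: "B \<in> borel_measurable borel" "integral\<^sup>N (total_variation \<rho>) B < \<infinity>"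
    and bound: "\<And>x p. x \<in> \<Omega> \<Longrightarrow> ennreal (cmod (K x p)) \<le> B p"
    and u: "integrable lborel u" "\<And>x. x \<notin> \<Omega> \<Longrightarrow> u x = (0::real)"
  shows "(LINT x|lborel. u x *\<^sub>R complex_integral \<rho> (K x))
    = complex_integral \<rho> (\<lambda>p. LINT x|lborel. u x *\<^sub>R K x p)"
proof -
  have *: "integrable lborel (\<lambda>x. u x *\<^sub>R integral\<^sup>L P (K x)) \<and>
      (LINT x|lborel. u x *\<^sub>R integral\<^sup>L P (K x)) = integral\<^sup>L P (\<lambda>p. LINT x|lborel. u x *\<^sub>R K x p)"
    if P: "P \<in> jordan_parts \<rho>" for P
  proof -
    interpret P: finite_measure P by (rule finite_measure_jordan_parts[OF \<rho> fin P])
    interpret LP: pair_sigma_finite "lborel :: 'a measure" P ..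
    let ?H = "\<lambda>(x, p). u x *\<^sub>R K x p"
    have [measurable_cong]: "sets P = sets borel" by (rule sets_jordan_parts[OF P])
    have "sets (lborel \<Otimes>\<^sub>M P) = sets (borel \<Otimes>\<^sub>M borel :: ('a \<times> 'b) measure)"
      using sets_jordan_parts[OF P] by (intro sets_pair_measure_cong) auto
    then have [measurable]: "(\<lambda>(x, p). K x p) \<in> borel_measurable (lborel \<Otimes>\<^sub>M P)"
      using K by (simp cong: measurable_cong_sets)
    note [measurable] = B(1) borel_measurable_integrable[OF u(1)]
    have "integrable (lborel \<Otimes>\<^sub>M P) ?H"
    proof (rule integrableI_bounded)
      have "(\<integral>\<^sup>+z. ennreal (norm (?H z)) \<partial>(lborel \<Otimes>\<^sub>M P))
          = (\<integral>\<^sup>+x. \<integral>\<^sup>+p. ennreal (norm (u x *\<^sub>R K x p)) \<partial>P \<partial>lborel)"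
        by (subst P.nn_integral_fst[symmetric]) auto
      also have "\<dots> \<le> (\<integral>\<^sup>+x. \<integral>\<^sup>+p. ennreal (norm (u x)) * B p \<partial>P \<partial>lborel)"
      proof (intro nn_integral_mono)
        fix x p
        show "ennreal (norm (u x *\<^sub>R K x p)) \<le> ennreal (norm (u x)) * B p"
          using bound[of x p] u(2)[of x]
          by (cases "x \<in> \<Omega>") (auto simp: ennreal_mult intro!: mult_left_mono)
      qed
      also have "\<dots> = (\<integral>\<^sup>+x. ennreal (norm (u x)) \<partial>lborel) * integral\<^sup>N P B"
        by (simp add: nn_integral_cmult nn_integral_multc)
      also have "\<dots> < \<infinity>"
        using u(1) le_less_trans[OF nn_integral_jordan_parts_le[OF \<rho> P] B(2)]
        by (simp add: integrable_iff_bounded ennreal_mult_less_top)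
      finally show "(\<integral>\<^sup>+z. ennreal (norm (?H z)) \<partial>(lborel \<Otimes>\<^sub>M P)) < \<infinity>" .
    qed simp
    note H = this
    show ?thesis
      using LP.integrable_fst'[OF H] LP.Fubini_integral[of "\<lambda>x p. u x *\<^sub>R K x p"] H by simp
  qed
  note int = *[THEN conjunct1] and eq = *[THEN conjunct2]
  let ?I = "\<lambda>P x. u x *\<^sub>R integral\<^sup>L P (K x)"
  let ?A = "positive_variation (\<lambda>A. Re (\<rho> A))" and ?B = "positive_variation (\<lambda>A. - Re (\<rho> A))"
  let ?C = "positive_variation (\<lambda>A. Im (\<rho> A))" and ?D = "positive_variation (\<lambda>A. - Im (\<rho> A))"
  have "(\<lambda>x. u x *\<^sub>R complex_integral \<rho> (K x))
      = (\<lambda>x. (?I ?A x - ?I ?B x) + \<i> * (?I ?C x - ?I ?D x))"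
    by (simp add: complex_integral_jordan_parts algebra_simps fun_eq_iff)
  then have "(LINT x|lborel. u x *\<^sub>R complex_integral \<rho> (K x))
      = (LINT x|lborel. (?I ?A x - ?I ?B x) + \<i> * (?I ?C x - ?I ?D x))" by simp
  also have "\<dots> = (integral\<^sup>L lborel (?I ?A) - integral\<^sup>L lborel (?I ?B))
      + \<i> * (integral\<^sup>L lborel (?I ?C) - integral\<^sup>L lborel (?I ?D))"
    by (simp add: int jordan_parts_mem)
  also have "\<dots> = complex_integral \<rho> (\<lambda>p. LINT x|lborel. u x *\<^sub>R K x p)"
    by (simp add: eq jordan_parts_mem complex_integral_jordan_parts)
  finally show ?thesis .
qed

text \<open>A Barron function is only Lebesgue measurable; testing it amounts to testing the Borel function
  that represents it, to which Fubini's theorem applies.\<close>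

lemma set_integral_lebesgue_AE_eq:
  fixes f g :: "'a::euclidean_space \<Rightarrow> complex"
  assumes \<Omega>: "\<Omega> \<in> sets borel" and f: "f \<in> borel_measurable (lebesgue_on \<Omega>)"
    and g[measurable]: "g \<in> borel_measurable borel" and fg: "AE x in lebesgue_on \<Omega>. f x = g x"
    and u[measurable]: "u \<in> borel_measurable borel" and zero: "\<And>x. x \<notin> \<Omega> \<Longrightarrow> u x = (0::real)"
  shows "(LINT x:\<Omega>|lebesgue. u x *\<^sub>R f x) = (LINT x|lborel. u x *\<^sub>R g x)"
proof -
  have \<Omega>': "\<Omega> \<inter> space lebesgue \<in> sets lebesgue" using \<Omega> by auto
  have m: "v \<in> borel_measurable (lebesgue_on \<Omega>)"
    if "v \<in> borel_measurable borel" for v :: "'a \<Rightarrow> 'c::topological_space"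
    using that by (intro measurable_restrict_space1 measurable_completion) simp
  have "(LINT x:\<Omega>|lebesgue. u x *\<^sub>R f x) = (LINT x|lebesgue_on \<Omega>. u x *\<^sub>R f x)"
    unfolding set_lebesgue_integral_def by (rule integral_restrict_space[OF \<Omega>', symmetric])
  also have "\<dots> = (LINT x|lebesgue_on \<Omega>. u x *\<^sub>R g x)"
    using fg by (intro integral_cong_AE borel_measurable_scaleR m f g u) auto
  also have "\<dots> = (LINT x|lebesgue. indicator \<Omega> x *\<^sub>R (u x *\<^sub>R g x))"
    by (rule integral_restrict_space[OF \<Omega>'])
  also have "\<dots> = (LINT x|lebesgue. u x *\<^sub>R g x)"
  proof (intro Bochner_Integration.integral_cong refl)
    fix x show "indicator \<Omega> x *\<^sub>R (u x *\<^sub>R g x) = u x *\<^sub>R g x"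
      using zero[of x] by (cases "x \<in> \<Omega>") auto
  qed
  also have "\<dots> = (LINT x|lborel. u x *\<^sub>R g x)"
    by (intro integral_completion) simp
  finally show ?thesis .
qed

lemma locally_integrable_bounded:
  fixes f :: "'a::euclidean_space \<Rightarrow> complex"
  assumes \<Omega>: "\<Omega> \<in> lmeasurable" and f: "f \<in> borel_measurable (lebesgue_on \<Omega>)"
    and bound: "AE x in lebesgue_on \<Omega>. cmod (f x) \<le> M"
  shows "locally_integrable \<Omega> f"
  unfolding locally_integrable_def
proof (intro allI impI)
  fix K :: "'a set" assume K: "compact K \<and> K \<subseteq> \<Omega>"
  interpret finite_measure "lebesgue_on \<Omega>" by (rule finite_measure_lebesgue_on[OF \<Omega>])
  have "integrable (lebesgue_on \<Omega>) f"
    by (rule integrable_const_bound[OF bound f])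
  then have "set_integrable lebesgue \<Omega> f"
    using \<Omega> unfolding set_integrable_def by (subst (asm) integrable_restrict_space) (auto dest: fmeasurableD)
  moreover have "K \<in> sets lebesgue"
    using K by (intro lmeasurable_compact fmeasurableD) auto
  ultimately show "set_integrable lebesgue K f"
    using K by (blast intro: set_integrable_subset)
qed

section \<open>Derivatives of Barron functions\<close>

text \<open>The integrand that represents \<open>\<partial>\<^sup>\<alpha> f\<close>, if \<open>d m\<close> is the derivative of order \<open>m\<close> of the activation
  function. It is a function on the parameter space, since it is integrated in \<open>(w, b)\<close>.\<close>

definition ridge :: "(nat \<Rightarrow> real \<Rightarrow> complex) \<Rightarrow> ('a::euclidean_space \<Rightarrow> nat) \<Rightarrow> 'a \<Rightarrow> 'a \<times> real \<Rightarrow> complex" where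
  "ridge d \<alpha> x = (\<lambda>(w, b). complex_of_real (mi_power w \<alpha>) * d (mi_order \<alpha>) (w \<bullet> x + b))"

lemma norm1_nonneg: "0 \<le> norm1 w"
  unfolding norm1_def by (simp add: sum_nonneg)

lemma mi_power_le:
  assumes "norm1 w \<le> r"
  shows "\<bar>mi_power w \<alpha>\<bar> \<le> r ^ mi_order \<alpha>"
proof -
  have "\<bar>w \<bullet> b\<bar> \<le> r" if "b \<in> Basis" for b
    using assms member_le_sum[of b Basis "\<lambda>b. \<bar>w \<bullet> b\<bar>"] that unfolding norm1_def by force
  then have "(\<Prod>b\<in>Basis. \<bar>w \<bullet> b\<bar> ^ \<alpha> b) \<le> (\<Prod>b\<in>Basis. r ^ \<alpha> b)"
    by (intro prod_mono) (auto intro!: power_mono)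
  then show ?thesis
    by (simp add: mi_power_def mi_order_def abs_prod power_abs power_sum)
qed

lemma abs_ridge_argument_le:
  assumes "x \<in> box 0 One"
  shows "\<bar>w \<bullet> x + b\<bar> \<le> norm1 w + \<bar>b\<bar>"
proof -
  have "\<bar>w \<bullet> x\<bar> \<le> (\<Sum>e\<in>Basis. \<bar>(w \<bullet> e) * (x \<bullet> e)\<bar>)"
    unfolding euclidean_inner[of w x] by (rule sum_abs)
  also have "\<dots> \<le> norm1 w"
    unfolding norm1_def using assms
    by (intro sum_mono) (force simp: abs_mult mem_box intro!: mult_left_le)
  finally show ?thesis by linarith
qed

lemma mi_power_zero: "mi_order \<alpha> \<noteq> 0 \<Longrightarrow> mi_power 0 \<alpha> = 0"
  by (auto simp: mi_power_def mi_order_def)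

text \<open>Lowering the exponent multiplies by a power of \<open>1 + x\<close>, which is again non-decreasing; so the
  hypothesis on the last reduced norm function covers all of them.\<close>

lemma mono_on_reduced_norm_function:
  assumes mono: "mono_on {0..} (reduced_norm_function \<phi> k)"
    and pos: "\<And>x. x \<ge> 0 \<Longrightarrow> 0 < reduced_norm_function \<phi> k x" and "m \<le> k"
  shows "mono_on {0..} (reduced_norm_function \<phi> m)"
proof (rule mono_onI)
  have eq: "reduced_norm_function \<phi> m x = reduced_norm_function \<phi> k x * (1 + x) ^ (k - m)" if "x \<ge> 0" for x
  proof -
    have "(1 + x) ^ k = (1 + x) ^ m * (1 + x) ^ (k - m)"
      using \<open>m \<le> k\<close> by (simp flip: power_add)
    then show ?thesis using that by (simp add: reduced_norm_function_def)
  qed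
  fix x y :: real assume xy: "x \<in> {0..}" "y \<in> {0..}" "x \<le> y"
  then have "reduced_norm_function \<phi> k x * (1 + x) ^ (k - m) \<le> reduced_norm_function \<phi> k y * (1 + y) ^ (k - m)"
    using pos[of y] by (intro mult_mono mono_onD[OF mono] power_mono) auto
  then show "reduced_norm_function \<phi> m x \<le> reduced_norm_function \<phi> m y"
    using xy by (simp add: eq)
qed

lemma borel_measurable_mono_on_abs:
  fixes f :: "real \<Rightarrow> real"
  assumes "mono_on {0..} f"
  shows "(\<lambda>s. f \<bar>s\<bar>) \<in> borel_measurable borel"
proof -
  have "mono (\<lambda>s. f (max 0 s))"
    using assms by (auto intro!: monoI mono_onD[OF assms])
  then have [measurable]: "(\<lambda>s. f (max 0 s)) \<in> borel_measurable borel"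
    by (rule borel_measurable_mono)
  have "(\<lambda>s. f (max 0 \<bar>s\<bar>)) \<in> borel_measurable borel"
    by (rule measurable_compose[of abs borel borel]) auto
  then show ?thesis by simp
qed

text \<open>The hypotheses on the activation function with one constant \<open>C\<close> and with successive
  first-order weak derivatives, \<open>d 0\<close> being the activation function. The bound on \<open>d 0\<close> holds
  everywhere, since a measure on the parameters may charge \<open>w = 0\<close>.\<close>

locale barron_activation =
  fixes \<phi> :: "real \<Rightarrow> real" and k :: nat and d :: "nat \<Rightarrow> real \<Rightarrow> complex" and C :: real
  assumes pos: "\<And>x. x \<ge> 0 \<Longrightarrow> 0 < \<phi> x"
    and mono: "\<And>m. m \<le> k \<Longrightarrow> mono_on {0..} (reduced_norm_function \<phi> m)"
    and C: "0 < C"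
    and borel: "\<And>m. m \<le> k \<Longrightarrow> d m \<in> borel_measurable borel"
    and bound_0: "\<And>s. cmod (d 0 s) \<le> C * \<phi> \<bar>s\<bar>"
    and bound_AE: "\<And>m. m \<le> k \<Longrightarrow> AE s in lborel. cmod (d m s) \<le> C * reduced_norm_function \<phi> m \<bar>s\<bar>"
    and weak: "\<And>m. m < k \<Longrightarrow> weak_deriv_1 (d m) (d (Suc m))"
begin

lemma reduced_0: "reduced_norm_function \<phi> 0 = \<phi>"
  by (simp add: reduced_norm_function_def fun_eq_iff)

lemma reduced_pos: "x \<ge> 0 \<Longrightarrow> 0 < reduced_norm_function \<phi> m x"
  using pos by (simp add: reduced_norm_function_def)

text \<open>Fubini's theorem and the chain rule are applied for every \<open>(w, b)\<close>, also for \<open>w = 0\<close>, where the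
  ridge function sees a single value of the profile. So the bound that holds almost everywhere is
  made to hold everywhere, by changing the derivatives on a null set.\<close>

definition cutoff :: "nat \<Rightarrow> real \<Rightarrow> complex" where
  "cutoff m s = (if cmod (d m s) \<le> C * reduced_norm_function \<phi> m \<bar>s\<bar> then d m s else 0)"

lemma cutoff_0: "cutoff 0 = d 0"
  using bound_0 by (simp add: cutoff_def fun_eq_iff reduced_0)

lemma cutoff_bound: "cmod (cutoff m s) \<le> C * reduced_norm_function \<phi> m \<bar>s\<bar>"
  using C reduced_pos[of "\<bar>s\<bar>" m] by (auto simp: cutoff_def)

lemma cutoff_borel: "m \<le> k \<Longrightarrow> cutoff m \<in> borel_measurable borel"
  unfolding cutoff_def[abs_def]
  using borel[of m] borel_measurable_mono_on_abs[OF mono[of m]] by measurable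

lemma cutoff_AE: "m \<le> k \<Longrightarrow> AE s in lborel. d m s = cutoff m s"
  using bound_AE[of m] by (auto simp: cutoff_def elim!: eventually_mono)

lemma cutoff_locally_bounded: "m \<le> k \<Longrightarrow> locally_bounded (cutoff m)"
  unfolding locally_bounded_def
proof (intro allI exI impI)
  fix R s :: real assume m: "m \<le> k" and s: "\<bar>s\<bar> \<le> R"
  have "reduced_norm_function \<phi> m \<bar>s\<bar> \<le> reduced_norm_function \<phi> m R"
    using s by (intro mono_onD[OF mono[OF m]]) auto
  then show "cmod (cutoff m s) \<le> C * reduced_norm_function \<phi> m R"
    using cutoff_bound[of m s] C by (meson mult_left_mono less_imp_le order_trans)
qed

lemma cutoff_weak:
  assumes "m < k"
  shows "weak_deriv_1 (cutoff m) (cutoff (Suc m))"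
  unfolding weak_deriv_1_def
proof (intro allI impI)
  fix \<psi> :: "real \<Rightarrow> real" assume \<psi>: "test_function UNIV \<psi>"
  have "test_function UNIV (iter_partial [1] \<psi>)"
    using \<psi> by (intro test_function_iter_partial) auto
  then have b: "\<psi> \<in> borel_measurable borel" "iter_partial [1] \<psi> \<in> borel_measurable borel"
    using \<psi> unfolding test_function_def by (auto intro: smooth_function_borel simp del: iter_partial.simps)
  have eq: "(LINT s|lborel. u s *\<^sub>R d n s) = (LINT s|lborel. u s *\<^sub>R cutoff n s)"
    if "u \<in> borel_measurable borel" "n \<le> k" for u :: "real \<Rightarrow> real" and n
    using that cutoff_AE[of n] borel[of n] cutoff_borel[of n] by (intro integral_cong_AE) auto
  show "(LINT s|lborel. iter_partial [1] \<psi> s *\<^sub>R cutoff m s) = - (LINT s|lborel. \<psi> s *\<^sub>R cutoff (Suc m) s)"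
    using weak[OF assms] \<psi> eq[OF b(1), of "Suc m"] eq[OF b(2), of m] assms
    unfolding weak_deriv_1_def by (simp del: iter_partial.simps)
qed

lemma ridge_borel:
  assumes h: "h (mi_order \<alpha>) \<in> borel_measurable borel"
  shows "(\<lambda>(x, p). ridge h \<alpha> x p) \<in> borel_measurable (borel \<Otimes>\<^sub>M borel)"
proof -
  have [measurable]: "(\<lambda>w. mi_power w \<alpha>) \<in> borel_measurable borel"
    unfolding mi_power_def by measurable
  note [measurable] = h
  have "(\<lambda>(x, p). ridge h \<alpha> x p)
      = (\<lambda>z. complex_of_real (mi_power (fst (snd z)) \<alpha>) * h (mi_order \<alpha>) (fst (snd z) \<bullet> fst z + snd (snd z)))"
    by (auto simp: ridge_def fun_eq_iff)
  also have "\<dots> \<in> borel_measurable (borel \<Otimes>\<^sub>M (borel \<Otimes>\<^sub>M borel))"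
    by measurable
  finally show ?thesis by (simp add: borel_prod)
qed

definition weight :: "'a::euclidean_space \<times> real \<Rightarrow> real" where
  "weight p = (case p of (w, b) \<Rightarrow> \<phi> (norm1 w + \<bar>b\<bar>))"

lemma weight_borel: "weight \<in> borel_measurable (borel :: ('a::euclidean_space \<times> real) measure)"
proof -
  have [measurable]: "(\<lambda>s. \<phi> \<bar>s\<bar>) \<in> borel_measurable borel"
    using borel_measurable_mono_on_abs[OF mono[of 0]] by (simp add: reduced_0)
  have [measurable]: "norm1 \<in> borel_measurable (borel :: 'a measure)"
    unfolding norm1_def[abs_def] by measurable
  have "(\<lambda>p::'a \<times> real. \<phi> \<bar>norm1 (fst p) + \<bar>snd p\<bar>\<bar>) \<in> borel_measurable (borel \<Otimes>\<^sub>M borel)"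
    by measurable
  moreover have "weight = (\<lambda>p::'a \<times> real. \<phi> \<bar>norm1 (fst p) + \<bar>snd p\<bar>\<bar>)"
    by (auto simp: weight_def fun_eq_iff norm1_nonneg split: prod.split)
  ultimately show ?thesis by (simp add: borel_prod)
qed

text \<open>Each factor of \<open>w\<close> is paid for by one factor of \<open>1 + \<parallel>w\<parallel>\<^sub>1 + |b|\<close> in the denominator of the
  reduced norm function.\<close>

lemma ridge_cutoff_bound:
  assumes \<alpha>: "mi_order \<alpha> \<le> k" and x: "x \<in> box 0 One"
  shows "cmod (ridge cutoff \<alpha> x p) \<le> C * weight p"
proof -
  obtain w b where p: "p = (w, b)" by force
  let ?m = "mi_order \<alpha>" and ?r = "norm1 w + \<bar>b\<bar>"
  have r: "?r \<ge> 0" using norm1_nonneg[of w] by simp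
  have "cmod (cutoff ?m (w \<bullet> x + b)) \<le> C * reduced_norm_function \<phi> ?m \<bar>w \<bullet> x + b\<bar>"
    by (rule cutoff_bound)
  also have "\<dots> \<le> C * reduced_norm_function \<phi> ?m ?r"
    using C r abs_ridge_argument_le[OF x, of w b]
    by (intro mult_left_mono mono_onD[OF mono[OF \<alpha>]]) auto
  finally have "cmod (ridge cutoff \<alpha> x p) \<le> (1 + ?r) ^ ?m * (C * reduced_norm_function \<phi> ?m ?r)"
    using r mi_power_le[of w "1 + ?r" \<alpha>] unfolding p ridge_def
    by (auto simp: norm_mult intro!: mult_mono)
  also have "\<dots> = C * weight p"
    using r by (simp add: p weight_def reduced_norm_function_def)
  finally show ?thesis .
qed

text \<open>For \<open>w = 0\<close> the ridge function does not forget null sets, but there the factor \<open>w\<^sup>\<alpha>\<close> vanishes,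
  unless \<open>\<alpha> = 0\<close>, and the cutoff does not change the activation function itself.\<close>

lemma ridge_AE_cutoff:
  assumes \<alpha>: "mi_order \<alpha> \<le> k"
  shows "AE x in lborel. ridge d \<alpha> x p = ridge cutoff \<alpha> x p"
proof -
  obtain w b where p: "p = (w, b)" by force
  show ?thesis
  proof (cases "w = 0")
    case True
    then show ?thesis
      using mi_power_zero[of \<alpha>] cutoff_0 by (cases "mi_order \<alpha> = 0") (auto simp: p ridge_def)
  next
    case False
    show ?thesis
      using AE_ridge[OF cutoff_AE[OF \<alpha>] False, of b] by (auto simp: p ridge_def elim!: eventually_mono)
  qed
qed

lemma weighted_mass_weight: "weighted_mass \<phi> \<rho> = (\<integral>\<^sup>+p. ennreal (weight p) \<partial>total_variation \<rho>)"
  unfolding weighted_mass_def weight_def by (intro nn_integral_cong) (auto split: prod.split)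

text \<open>The weight is bounded below by \<open>\<phi> 0 > 0\<close>.\<close>

lemma total_variation_finite:
  assumes "\<rho> \<in> weighted_measures \<phi>"
  shows "emeasure (total_variation \<rho>) UNIV < \<infinity>"
proof -
  have "ennreal (\<phi> 0) * emeasure (total_variation \<rho>) UNIV = (\<integral>\<^sup>+p. ennreal (\<phi> 0) \<partial>total_variation \<rho>)"
    by simp
  also have "\<dots> \<le> weighted_mass \<phi> \<rho>"
    unfolding weighted_mass_weight
  proof (intro nn_integral_mono ennreal_leI)
    fix p :: "'a \<times> real"
    have "0 \<le> norm1 (fst p) + \<bar>snd p\<bar>" using norm1_nonneg[of "fst p"] by simp
    then have "\<phi> 0 \<le> \<phi> (norm1 (fst p) + \<bar>snd p\<bar>)"
      by (intro mono_onD[OF mono[of 0, unfolded reduced_0]]) auto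
    then show "\<phi> 0 \<le> weight p" by (simp add: weight_def split_beta)
  qed
  also have "\<dots> < \<infinity>" using assms by (simp add: weighted_measures_def)
  finally show ?thesis
    using pos[of 0] by (auto simp: ennreal_mult_less_top)
qed

text \<open>For a fixed \<open>(w, b)\<close> the identity of weak derivatives is the chain rule for ridge functions;
  integrating it against \<open>\<rho>\<close> gives it for \<open>f\<close>, and Fubini's theorem applies because test functions
  are integrable and the ridge functions are dominated by the weight, uniformly on the cube. The
  constant is \<open>C\<close> for each of the four parts of \<open>\<rho>\<close>.\<close>

theorem barron_weak_derivative:
  fixes f :: "'a::euclidean_space \<Rightarrow> complex"
  assumes f: "f \<in> borel_measurable (lebesgue_on (box 0 One))"
    and \<rho>: "\<rho> \<in> weighted_measures \<phi>" and rep: "represents (d 0) (box 0 One) \<rho> f"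
    and \<alpha>: "mi_order \<alpha> \<le> k"
  shows "AE x in lebesgue_on (box 0 One). integrable (total_variation \<rho>) (ridge d \<alpha> x)"
    and "has_weak_deriv (box 0 One) \<alpha> f (\<lambda>x. complex_integral \<rho> (ridge d \<alpha> x))"
    and "Linf_norm (box 0 One) (\<lambda>x. complex_integral \<rho> (ridge d \<alpha> x)) \<le> ennreal (4 * C) * weighted_mass \<phi> \<rho>"
proof -
  let ?\<Omega> = "box 0 One :: 'a set" and ?\<mu> = "total_variation \<rho>"
  have cm: "complex_measure \<rho>" and mass: "weighted_mass \<phi> \<rho> < \<infinity>"
    using \<rho> by (auto simp: weighted_measures_def)
  note fin = total_variation_finite[OF \<rho>]
  let ?B = "\<lambda>p::'a \<times> real. ennreal (C * weight p)"
  have weight_nonneg: "0 \<le> weight p" for p :: "'a \<times> real"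
    using pos[of "norm1 (fst p) + \<bar>snd p\<bar>"] norm1_nonneg[of "fst p"] by (simp add: weight_def split_beta)
  have B: "?B \<in> borel_measurable borel" using weight_borel by measurable
  have w\<mu>: "weight \<in> borel_measurable ?\<mu>"
    using weight_borel by (subst measurable_cong_sets[OF sets_total_variation refl])
  have intB: "integral\<^sup>N ?\<mu> ?B = ennreal C * weighted_mass \<phi> \<rho>"
    unfolding weighted_mass_weight using w\<mu> C weight_nonneg
    by (subst nn_integral_cmult[symmetric]) (auto simp: ennreal_mult)
  then have finB: "integral\<^sup>N ?\<mu> ?B < \<infinity>"
    using mass by (simp add: ennreal_mult_less_top)
  have \<Omega>: "?\<Omega> \<in> sets borel" "?\<Omega> \<in> lmeasurable" by auto

  define G where "G \<beta> x = complex_integral \<rho> (ridge cutoff \<beta> x)" for \<beta> x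
  have G_borel: "G \<beta> \<in> borel_measurable borel" if "mi_order \<beta> \<le> k" for \<beta>
    unfolding G_def
    by (rule borel_measurable_complex_integral[OF cm fin ridge_borel[where h = cutoff, OF cutoff_borel[OF that]]])
  have ridge_le: "ennreal (cmod (ridge cutoff \<beta> x p)) \<le> ?B p" if "mi_order \<beta> \<le> k" "x \<in> ?\<Omega>" for \<beta> x p
    by (intro ennreal_leI ridge_cutoff_bound that)
  have G_bound: "ennreal (cmod (G \<beta> x)) \<le> ennreal (4 * C) * weighted_mass \<phi> \<rho>"
    if "mi_order \<beta> \<le> k" "x \<in> ?\<Omega>" for \<beta> x
  proof -
    have "ennreal (cmod (G \<beta> x)) \<le> 4 * integral\<^sup>N ?\<mu> ?B"
      unfolding G_def by (intro complex_integral_bound[OF cm] ridge_le that)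
    then show ?thesis using C by (simp add: intB ennreal_mult mult.assoc)
  qed

  have AE_x: "AE x in lborel. AE p in ?\<mu>. ridge d \<beta> x p = ridge cutoff \<beta> x p" if \<beta>: "mi_order \<beta> \<le> k" for \<beta>
  proof -
    interpret \<mu>: finite_measure ?\<mu> by (rule finite_measureI) (use fin in simp)
    interpret pr: pair_sigma_finite "lborel :: 'a measure" ?\<mu> ..
    have s: "sets (lborel \<Otimes>\<^sub>M ?\<mu>) = sets (borel \<Otimes>\<^sub>M borel :: ('a \<times> ('a \<times> real)) measure)"
      by (intro sets_pair_measure_cong) auto
    have [measurable]: "(\<lambda>(x, p). ridge d \<beta> x p) \<in> borel_measurable (lborel \<Otimes>\<^sub>M ?\<mu>)"
      "(\<lambda>(x, p). ridge cutoff \<beta> x p) \<in> borel_measurable (lborel \<Otimes>\<^sub>M ?\<mu>)"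
      using ridge_borel[where h = d, OF borel[OF \<beta>]] ridge_borel[where h = cutoff, OF cutoff_borel[OF \<beta>]]
      by (simp_all add: measurable_cong_sets[OF s refl])
    have "AE p in ?\<mu>. AE x in lborel. ridge d \<beta> x p = ridge cutoff \<beta> x p"
      by (intro AE_I2 ridge_AE_cutoff \<beta>)
    then show ?thesis
      by (subst pr.AE_commute) measurable
  qed
  have to_\<Omega>: "AE x in lebesgue_on ?\<Omega>. Q x" if "AE x in lborel. x \<in> ?\<Omega> \<longrightarrow> Q x" for Q
    using that \<Omega>(1) by (subst AE_restrict_space_iff) (auto intro: AE_completion)
  have section_borel: "ridge h \<beta> x \<in> borel_measurable borel"
    if "h (mi_order \<beta>) \<in> borel_measurable borel" for h \<beta> and x :: 'a
    using measurable_compose_Pair1[OF _ ridge_borel[where h = h and \<alpha> = \<beta>, OF that], of x] by simp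

  show "AE x in lebesgue_on ?\<Omega>. integrable ?\<mu> (ridge d \<alpha> x)"
  proof (rule to_\<Omega>, use AE_x[OF \<alpha>] in \<open>rule eventually_mono\<close>, rule impI)
    fix x :: 'a assume eq: "AE p in ?\<mu>. ridge d \<alpha> x p = ridge cutoff \<alpha> x p" and x: "x \<in> ?\<Omega>"
    have "integrable ?\<mu> (ridge cutoff \<alpha> x)"
    proof (rule integrableI_bounded)
      show "ridge cutoff \<alpha> x \<in> borel_measurable ?\<mu>"
        using section_borel[of cutoff \<alpha> x] cutoff_borel[OF \<alpha>] by simp
      have "(\<integral>\<^sup>+p. ennreal (cmod (ridge cutoff \<alpha> x p)) \<partial>?\<mu>) \<le> integral\<^sup>N ?\<mu> ?B"
        by (intro nn_integral_mono ridge_le \<alpha> x)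
      then show "(\<integral>\<^sup>+p. ennreal (cmod (ridge cutoff \<alpha> x p)) \<partial>?\<mu>) < \<infinity>"
        using finB by (rule le_less_trans)
    qed
    then show "integrable ?\<mu> (ridge d \<alpha> x)"
      using eq section_borel[of cutoff \<alpha> x] cutoff_borel[OF \<alpha>] section_borel[of d \<alpha> x] borel[OF \<alpha>]
      by (subst integrable_cong_AE[where g = "ridge cutoff \<alpha> x"]) auto
  qed

  let ?g = "\<lambda>x. complex_integral \<rho> (ridge d \<alpha> x)"
  have g_borel: "?g \<in> borel_measurable borel"
    by (rule borel_measurable_complex_integral[OF cm fin ridge_borel[where h = d, OF borel[OF \<alpha>]]])
  have g_lebesgue: "v \<in> borel_measurable (lebesgue_on ?\<Omega>)"
    if "v \<in> borel_measurable borel" for v :: "'a \<Rightarrow> 'c::topological_space"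
    using that by (intro measurable_restrict_space1 measurable_completion) simp
  have gG: "AE x in lebesgue_on ?\<Omega>. ?g x = G \<alpha> x"
  proof (rule to_\<Omega>, use AE_x[OF \<alpha>] in \<open>rule eventually_mono\<close>, rule impI)
    fix x :: 'a assume eq: "AE p in ?\<mu>. ridge d \<alpha> x p = ridge cutoff \<alpha> x p"
    then show "?g x = G \<alpha> x"
      unfolding G_def
      by (intro complex_integral_cong_AE[OF cm] section_borel borel cutoff_borel \<alpha>)
  qed
  have AE_\<Omega>: "AE x in lebesgue_on ?\<Omega>. x \<in> ?\<Omega>"
    by (rule to_\<Omega>) simp
  have fG: "AE x in lebesgue_on ?\<Omega>. f x = G (\<lambda>_. 0) x"
    using rep unfolding represents_def G_def ridge_def
    by (simp add: mi_power_def mi_order_def cutoff_0)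
  have bounded_M: "AE x in lebesgue_on ?\<Omega>. cmod (v x) \<le> enn2real (ennreal (4 * C) * weighted_mass \<phi> \<rho>)"
    if "AE x in lebesgue_on ?\<Omega>. v x = G \<beta> x" "mi_order \<beta> \<le> k" for v \<beta>
    using that(1) AE_\<Omega>
  proof eventually_elim
    case (elim x)
    have "ennreal (4 * C) * weighted_mass \<phi> \<rho> < top"
      using mass by (simp add: ennreal_mult_less_top)
    then show ?case
      using G_bound[OF that(2) elim(2)] elim(1)
      by (metis enn2real_ennreal enn2real_mono norm_ge_zero)
  qed
  have order_0: "mi_order (\<lambda>_::'a. 0) \<le> k" by (simp add: mi_order_def)

  show "Linf_norm ?\<Omega> ?g \<le> ennreal (4 * C) * weighted_mass \<phi> \<rho>"
    unfolding Linf_norm_def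
  proof (rule esssup_I)
    show "(\<lambda>x. ennreal (cmod (?g x))) \<in> borel_measurable (lebesgue_on ?\<Omega>)"
      using g_lebesgue[OF g_borel] by measurable
    show "AE x in lebesgue_on ?\<Omega>. ennreal (cmod (?g x)) \<le> ennreal (4 * C) * weighted_mass \<phi> \<rho>"
      using gG AE_\<Omega> by eventually_elim (use G_bound[OF \<alpha>] in auto)
  qed

  show "has_weak_deriv ?\<Omega> \<alpha> f ?g"
    unfolding has_weak_deriv_def
  proof (intro conjI allI impI)
    show "locally_integrable ?\<Omega> f"
      by (rule locally_integrable_bounded[OF \<Omega>(2) f bounded_M[OF fG order_0]])
    show "locally_integrable ?\<Omega> ?g"
      by (rule locally_integrable_bounded[OF \<Omega>(2) g_lebesgue[OF g_borel] bounded_M[OF gG \<alpha>]])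
  next
    fix \<psi> :: "'a \<Rightarrow> real" assume \<psi>: "test_function ?\<Omega> \<psi>"
    obtain bs where bs: "mi_partial \<alpha> = iter_partial bs" "set bs \<subseteq> Basis" "length bs = mi_order \<alpha>"
      and power: "\<forall>w. prod_list (map (\<lambda>e. w \<bullet> e) bs) = mi_power w \<alpha>"
      using mi_partial_list[of \<alpha>] by blast
    let ?m = "mi_order \<alpha>"
    have \<psi>': "test_function ?\<Omega> (mi_partial \<alpha> \<psi>)"
      unfolding bs(1) by (rule test_function_iter_partial[OF \<psi> bs(2)])
    have integrable: "integrable lborel u" and u_borel: "u \<in> borel_measurable borel"
      if u: "test_function ?\<Omega> u" for u
    proof -
      have "integrable lborel (\<lambda>x. Re (u x *\<^sub>R 1))"
        by (intro integrable_Re integrable_test_function_ridge[OF u, of "\<lambda>_. 1"])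
           (auto simp: locally_bounded_def)
      then show "integrable lborel u" by simp
      show "u \<in> borel_measurable borel"
        using u by (auto simp: test_function_def intro: smooth_function_borel)
    qed
    have Fubini: "(LINT x|lborel. u x *\<^sub>R G \<beta> x) = complex_integral \<rho> (\<lambda>p. LINT x|lborel. u x *\<^sub>R ridge cutoff \<beta> x p)"
      if u: "test_function ?\<Omega> u" and \<beta>: "mi_order \<beta> \<le> k" for u \<beta>
      unfolding G_def
      by (rule complex_integral_Fubini[OF cm fin ridge_borel[where h = cutoff, OF cutoff_borel[OF \<beta>]] B finB
            ridge_le[OF \<beta>] integrable[OF u] test_function_outside[OF u]])
    have slice: "(LINT x|lborel. mi_partial \<alpha> \<psi> x *\<^sub>R ridge cutoff (\<lambda>_. 0) x p)
        = (- 1) ^ ?m * (LINT x|lborel. \<psi> x *\<^sub>R ridge cutoff \<alpha> x p)" for p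
    proof -
      obtain w b where p: "p = (w, b)" by force
      have "(LINT x|lborel. mi_partial \<alpha> \<psi> x *\<^sub>R ridge cutoff (\<lambda>_. 0) x p)
          = (LINT x|lborel. iter_partial bs \<psi> x *\<^sub>R cutoff 0 (w \<bullet> x + b))"
        by (simp add: bs(1) p ridge_def mi_power_def mi_order_def)
      also have "\<dots> = ((- 1) ^ ?m * mi_power w \<alpha>) *\<^sub>R (LINT x|lborel. \<psi> x *\<^sub>R cutoff ?m (w \<bullet> x + b))"
        using ridge_iter_partial[of ?\<Omega> \<psi> bs 0 k cutoff w b] \<psi> bs(2,3) \<alpha> power
          cutoff_borel cutoff_locally_bounded cutoff_weak by simp
      also have "\<dots> = (- 1) ^ ?m * (LINT x|lborel. \<psi> x *\<^sub>R ridge cutoff \<alpha> x p)"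
      proof -
        have "(LINT x|lborel. \<psi> x *\<^sub>R ridge cutoff \<alpha> x p)
            = (LINT x|lborel. mi_power w \<alpha> *\<^sub>R (\<psi> x *\<^sub>R cutoff ?m (w \<bullet> x + b)))"
          by (simp add: p ridge_def scaleR_conv_of_real mult_ac)
        then show ?thesis by (simp add: scaleR_conv_of_real mult.assoc)
      qed
      finally show ?thesis .
    qed
    have "(LINT x:?\<Omega>|lebesgue. mi_partial \<alpha> \<psi> x *\<^sub>R f x) = (LINT x|lborel. mi_partial \<alpha> \<psi> x *\<^sub>R G (\<lambda>_. 0) x)"
      by (rule set_integral_lebesgue_AE_eq[OF \<Omega>(1) f G_borel[OF order_0] fG u_borel[OF \<psi>'] test_function_outside[OF \<psi>']])
    also have "\<dots> = complex_integral \<rho> (\<lambda>p. (- 1) ^ ?m * (LINT x|lborel. \<psi> x *\<^sub>R ridge cutoff \<alpha> x p))"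
      by (simp only: Fubini[OF \<psi>' order_0] slice)
    also have "\<dots> = (- 1) ^ ?m * (LINT x|lborel. \<psi> x *\<^sub>R G \<alpha> x)"
      by (simp only: complex_integral_mult_right Fubini[OF \<psi> \<alpha>])
    also have "(LINT x|lborel. \<psi> x *\<^sub>R G \<alpha> x) = (LINT x:?\<Omega>|lebesgue. \<psi> x *\<^sub>R ?g x)"
      by (rule set_integral_lebesgue_AE_eq[OF \<Omega>(1) g_lebesgue[OF g_borel] G_borel[OF \<alpha>] gG u_borel[OF \<psi>] test_function_outside[OF \<psi>], symmetric])
    finally show "(LINT x:?\<Omega>|lebesgue. mi_partial \<alpha> \<psi> x *\<^sub>R f x) = (- 1) ^ ?m * (LINT x:?\<Omega>|lebesgue. \<psi> x *\<^sub>R ?g x)" .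
  qed
qed

end

section \<open>The embedding theorem\<close>

theorem theorem2p3:
  fixes \<Omega> :: "'a::euclidean_space set" and k :: nat
    and \<sigma> :: "real \<Rightarrow> complex" and \<phi> :: "real \<Rightarrow> real"
    and d\<sigma> :: "nat \<Rightarrow> real \<Rightarrow> complex"
  assumes "\<Omega> = box 0 One"
    and "activation_function \<sigma>"
    and "\<sigma> \<in> sobolev_loc_1 k UNIV"
    and "norm_function \<sigma> \<phi>"
    and "d\<sigma> 0 = \<sigma>"
    and "\<And>m. m \<le> k \<Longrightarrow> d\<sigma> m \<in> borel_measurable borel \<and> has_weak_deriv UNIV (\<lambda>_. m) \<sigma> (d\<sigma> m)"
    and "\<exists>C>0. \<forall>m\<le>k. AE x in lebesgue. cmod (d\<sigma> m x) \<le> C * reduced_norm_function \<phi> m \<bar>x\<bar>"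
    and "mono_on {0..} (reduced_norm_function \<phi> k)"
    and "\<forall>x\<ge>0. 0 < reduced_norm_function \<phi> k x"
  shows "(\<forall>f \<in> barron_space \<sigma> \<phi> \<Omega>. \<forall>\<rho> \<in> weighted_measures \<phi>. represents \<sigma> \<Omega> \<rho> f \<longrightarrow>
            (\<forall>\<alpha>. mi_order \<alpha> \<le> k \<longrightarrow>
               (AE x in lebesgue_on \<Omega>. integrable (total_variation \<rho>)
                  (\<lambda>(w, b). complex_of_real (mi_power w \<alpha>) * d\<sigma> (mi_order \<alpha>) (w \<bullet> x + b))) \<and>
               has_weak_deriv \<Omega> \<alpha> f (\<lambda>x. complex_integral \<rho>
                  (\<lambda>(w, b). complex_of_real (mi_power w \<alpha>) * d\<sigma> (mi_order \<alpha>) (w \<bullet> x + b)))))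
       \<and> barron_space \<sigma> \<phi> \<Omega> \<subseteq> sobolev_inf k \<Omega>
       \<and> (\<exists>C'>0. \<forall>f \<in> barron_space \<sigma> \<phi> \<Omega>.
            sobolev_inf_norm k \<Omega> f \<le> ennreal C' * barron_norm \<sigma> \<phi> \<Omega> f)"
proof -
  obtain C\<^sub>1 where C\<^sub>1: "C\<^sub>1 > 0" "\<And>x. cmod (\<sigma> x) \<le> C\<^sub>1 * \<phi> \<bar>x\<bar>"
    using assms(4) unfolding norm_function_def by blast
  obtain C\<^sub>2 where C\<^sub>2: "C\<^sub>2 > 0"
    "\<And>m. m \<le> k \<Longrightarrow> AE x in lebesgue. cmod (d\<sigma> m x) \<le> C\<^sub>2 * reduced_norm_function \<phi> m \<bar>x\<bar>"
    using assms(7) by blast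
  have pos: "0 < \<phi> x" if "x \<ge> 0" for x
    using assms(4) that unfolding norm_function_def by blast
  define C where "C = max C\<^sub>1 C\<^sub>2"
  have C: "0 < C" "C\<^sub>1 \<le> C" "C\<^sub>2 \<le> C" using C\<^sub>1(1) unfolding C_def by auto
  interpret barron_activation \<phi> k d\<sigma> C
  proof
    show "0 < \<phi> x" if "x \<ge> 0" for x by (rule pos[OF that])
    show "mono_on {0..} (reduced_norm_function \<phi> m)" if "m \<le> k" for m
      using mono_on_reduced_norm_function[OF assms(8) _ that] assms(9) by blast
    show "0 < C" by (rule C(1))
    show "d\<sigma> m \<in> borel_measurable borel" if "m \<le> k" for m
      using assms(6)[OF that] by blast
    show "cmod (d\<sigma> 0 s) \<le> C * \<phi> \<bar>s\<bar>" for s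
      using C\<^sub>1(2)[of s] C(2) pos[of "\<bar>s\<bar>"] unfolding assms(5)
      by (meson abs_ge_zero less_imp_le mult_right_mono order_trans)
    show "AE s in lborel. cmod (d\<sigma> m s) \<le> C * reduced_norm_function \<phi> m \<bar>s\<bar>" if "m \<le> k" for m
      using C\<^sub>2(2)[OF that] unfolding AE_completion_iff
    proof eventually_elim
      case (elim s)
      have "0 \<le> reduced_norm_function \<phi> m \<bar>s\<bar>"
        using pos[of "\<bar>s\<bar>"] by (simp add: reduced_norm_function_def)
      then show ?case using elim C(3) by (meson mult_right_mono order_trans)
    qed
    show "weak_deriv_1 (d\<sigma> m) (d\<sigma> (Suc m))" if "m < k" for m
      unfolding weak_deriv_1_def
    proof (intro allI impI)
      fix \<psi> :: "real \<Rightarrow> real" assume \<psi>: "test_function UNIV \<psi>"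
      have "test_function UNIV (iter_partial [1] \<psi>)"
        using \<psi> by (intro test_function_iter_partial) auto
      then have [measurable]: "\<psi> \<in> borel_measurable borel" "iter_partial [1] \<psi> \<in> borel_measurable borel"
        using \<psi> unfolding test_function_def by (auto intro: smooth_function_borel simp del: iter_partial.simps)
      have m: "m \<le> k" "Suc m \<le> k" using that by auto
      note [measurable] = assms(6)[OF m(1), THEN conjunct1] assms(6)[OF m(2), THEN conjunct1]
      have "(LINT s|lebesgue. iter_partial [1] \<psi> s *\<^sub>R d\<sigma> m s) = (LINT s|lborel. iter_partial [1] \<psi> s *\<^sub>R d\<sigma> m s)"
        "(LINT s|lebesgue. \<psi> s *\<^sub>R d\<sigma> (Suc m) s) = (LINT s|lborel. \<psi> s *\<^sub>R d\<sigma> (Suc m) s)"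
        by (rule integral_completion, measurable)+
      then show "(LINT s|lborel. iter_partial [1] \<psi> s *\<^sub>R d\<sigma> m s) = - (LINT s|lborel. \<psi> s *\<^sub>R d\<sigma> (Suc m) s)"
        using weak_deriv_successive[OF assms(6)[OF m(1), THEN conjunct2] assms(6)[OF m(2), THEN conjunct2] \<psi>]
        by (simp only:)
    qed
  qed
  have main: "(AE x in lebesgue_on \<Omega>. integrable (total_variation \<rho>) (ridge d\<sigma> \<alpha> x))"
    "has_weak_deriv \<Omega> \<alpha> f (\<lambda>x. complex_integral \<rho> (ridge d\<sigma> \<alpha> x))"
    "Linf_norm \<Omega> (\<lambda>x. complex_integral \<rho> (ridge d\<sigma> \<alpha> x)) \<le> ennreal (4 * C) * weighted_mass \<phi> \<rho>"
    if "f \<in> barron_space \<sigma> \<phi> \<Omega>" "\<rho> \<in> weighted_measures \<phi>" "represents \<sigma> \<Omega> \<rho> f" "mi_order \<alpha> \<le> k"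
    for f \<rho> and \<alpha> :: "'a \<Rightarrow> nat"
    using barron_weak_derivative[of f \<rho> \<alpha>] that unfolding assms(1) assms(5) barron_space_def by blast+
  have "f \<in> sobolev_inf k \<Omega>" if f: "f \<in> barron_space \<sigma> \<phi> \<Omega>" for f
  proof -
    obtain \<rho> where \<rho>: "\<rho> \<in> weighted_measures \<phi>" "represents \<sigma> \<Omega> \<rho> f"
      using f unfolding barron_space_def by blast
    have "ennreal (4 * C) * weighted_mass \<phi> \<rho> < \<infinity>"
      using \<rho>(1) by (simp add: weighted_measures_def ennreal_mult_less_top)
    then show ?thesis
      unfolding sobolev_inf_def using main(2,3)[OF f \<rho>] le_less_trans by blast
  qed
  moreover have "sobolev_inf_norm k \<Omega> f \<le> ennreal (4 * C) * barron_norm \<sigma> \<phi> \<Omega> f"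
    if f: "f \<in> barron_space \<sigma> \<phi> \<Omega>" for f
    unfolding sobolev_inf_norm_def
  proof (rule SUP_least)
    fix \<alpha> :: "'a \<Rightarrow> nat" assume "\<alpha> \<in> {\<alpha>. mi_order \<alpha> \<le> k}"
    then have \<alpha>: "mi_order \<alpha> \<le> k" by simp
    let ?N = "INF g\<in>{g. has_weak_deriv \<Omega> \<alpha> f g}. Linf_norm \<Omega> g"
    have inv: "ennreal (4 * C) * (ennreal (1 / (4 * C)) * x) = x"
      "ennreal (1 / (4 * C)) * (ennreal (4 * C) * x) = x" for x
      using C(1) by (simp_all add: mult.assoc[symmetric] ennreal_mult[symmetric])
    have "ennreal (1 / (4 * C)) * ?N \<le> barron_norm \<sigma> \<phi> \<Omega> f"
      unfolding barron_norm_def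
    proof (rule INF_greatest)
      fix \<rho> assume "\<rho> \<in> {\<rho> \<in> weighted_measures \<phi>. represents \<sigma> \<Omega> \<rho> f}"
      then have \<rho>: "\<rho> \<in> weighted_measures \<phi>" "represents \<sigma> \<Omega> \<rho> f" by auto
      have "?N \<le> ennreal (4 * C) * weighted_mass \<phi> \<rho>"
        using main(2,3)[OF f \<rho> \<alpha>] by (intro INF_lower2) auto
      then show "ennreal (1 / (4 * C)) * ?N \<le> weighted_mass \<phi> \<rho>"
        using mult_left_mono[of ?N _ "ennreal (1 / (4 * C))"] inv(2) by (metis zero_le)
    qed
    then show "?N \<le> ennreal (4 * C) * barron_norm \<sigma> \<phi> \<Omega> f"
      using mult_left_mono[of _ _ "ennreal (4 * C)"] inv(1) by (metis zero_le)
  qed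
  moreover have "4 * C > 0" using C(1) by simp
  ultimately show ?thesis
    using main(1,2) unfolding ridge_def by blast
qed

end
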